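(* Let $f\in C^{r+1}([-1,1])$, let $\nu\in\{1,\dots,r\}$, and set $\hat R_{r,n}[f]:=f-\hat P_{r,n}[f]$. Then $$\left\lVert \hat R_{r,n}^{(\nu)}[f]\right\rVert_\infty=\left\lVert f^{(\nu)}-\hat P_{r,n}^{(\nu)}[f]\right\rVert_\infty\le \frac{\prod_{j=0}^{\nu-1}\left((r+1)^2-j^2\right)}{\prod_{j=0}^{\nu-1}(2j+1)}\,\lVert\omega_r\rVert_\infty\,\frac{\lVert f^{(r+1)}\rVert_\infty}{\nu!\,(r+1-\nu)!}+\frac{\prod_{j=0}^{\nu-1}\left(r^2-j^2\right)}{\prod_{j=0}^{\nu-1}(2j+1)}\,\sum_{k=0}^p\lVert\ell_{k,p}\rVert_\infty\left(\frac{\pi}{2}\right)^r(1+B_n)\,\frac{\lVert f^{(r)}\rVert_\infty}{(r+1)!},$$ where $$\omega_r(x)=\prod_{k=0}^m(x-x'_k)\prod_{s=0}^p(x-x'''_s),\qquad \ell_{j,p}(x)=\prod_{k=0}^{m}\frac{x-x'_k}{x'''_j-x'_k}\ \prod_{\substack{s=0\\ s\ne j}}^{p}\frac{x-x'''_s}{x'''_j-x'''_s}\quad(j=0,\dots,p),$$ and $B_n:=2(r+1)\,\kappa(M)+(m+1)\lVert M^{-1}\rVert_1$ with $\kappa(M)=\lVert M\rVert_1\lVert M^{-1}\rVert_1$.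
   Context: Let $n$ be a (sufficiently large) positive integer and let $X_n=\{-1+\tfrac{2}{n}i : i=0,\dots,n\}$ be the set of $n+1$ equispaced nodes in $[-1,1]$. Put $m=\lfloor \pi\sqrt{n/2}\rfloor$, $p=\lfloor \tfrac{\pi}{\sqrt2}\sqrt{n/6}\rfloor$, $r=m+p+1$; $n$ is large enough that $r\le n$. $\Pi_k$ denotes the space of real polynomials of degree $\le k$. $X'_m=\{x'_0,\dots,x'_m\}\subset X_n$ is the mock-Chebyshev subset: $m+1$ pairwise distinct nodes of $X_n$ that best mimic the Chebyshev--Lobatto nodes, i.e. $x'_k$ is the node of $X_n$ closest to $-\cos(k\pi/m)$ (a neighbouring grid node being used if necessary to keep the nodes distinct). The elements of $X_n$ are reordered as $x_0,\dots,x_n$ so that $x_i=x'_i$ for $i=0,\dots,m$. Let $X''_{n-m}=X_n\setminus X'_m$. For $n$ sufficiently large an equispaced grid of $q=\lfloor n/6\rfloor$ internal nodes of $[-1,1]$ can be approximated by $q$ distinct nodes belonging to $X''_{n-m}$; this set of nodes is denoted $\tilde X''_{n-m}$. $X'''_p=\{x'''_0,\dots,x'''_p\}$ is the mock-Chebyshev subset of $\tilde X''_{n-m}$, i.e. $p+1$ pairwise distinct points of $\tilde X''_{n-m}$ chosen to best mimic Chebyshev--Lobatto nodes. In particular $X'_m\cup X'''_p$ consists of $r+1$ distinct points of $X_n$. The basis of $\Pi_r$ used is the Chebyshev basis of the first kind, $u_k(x)=T_k(x)=\cos(k\arccos x)$, $k=0,\dots,r$. Let $V=[T_j(x_i)]_{i=0,\dots,n;\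 j=0,\dots,r}$ and $C=[T_j(x_i)]_{i=0,\dots,m;\ j=0,\dots,r}$. The KKT matrix $$M=\begin{bmatrix}2V^TV & C^T\\ C&0\end{bmatrix}$$ is nonsingular. For $f\in C([-1,1])$ let $\boldsymbol b=[f(x_0),\dots,f(x_n)]^T$, $\boldsymbol d=[f(x_0),\dots,f(x_m)]^T$, and let $(\hat{\boldsymbol a},\hat{\boldsymbol z})$ with $\hat{\boldsymbol a}=[\hat a_0,\dots,\hat a_r]^T$, $\hat{\boldsymbol z}\in\mathbb R^{m+1}$, be the unique solution of $$M\begin{bmatrix}\hat{\boldsymbol a}\\ \hat{\boldsymbol z}\end{bmatrix}=\begin{bmatrix}2V^T\boldsymbol b\\ \boldsymbol d\end{bmatrix}.$$ The constrained mock-Chebyshev least squares operator is $\hat P_{r,n}[f](x)=\sum_{i=0}^r\hat a_iT_i(x)$, $x\in[-1,1]$; $\hat P^{(\nu)}_{r,n}[f]$ and $\hat R^{(\nu)}_{r,n}[f]$ denote the $\nu$-th derivatives in $x$ of $\hat P_{r,n}[f]$ and $\hat R_{r,n}[f]$. $\lVert\cdot\rVert_\infty$ is the sup norm on $[-1,1]$; $\lVert\cdot\rVert_1$ of a matrix is the operator norm induced by the vector $1$-norm (maximum absolute column sum). *)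

theory Defs
  imports
    "HOL-Analysis.Analysis"
    "Jordan_Normal_Form.Gauss_Jordan_Elimination"
begin

unbundle no vec_syntax

text \<open>
  Derivatives on \<open>[-1,1]\<close> are taken within the interval, hence one-sided at the end points; they
  only depend on the values of the function on \<open>[-1,1]\<close>.
\<close>

definition nderiv :: "nat \<Rightarrow> (real \<Rightarrow> real) \<Rightarrow> real \<Rightarrow> real" where
  "nderiv k f = ((\<lambda>g x. vector_derivative g (at x within {-1..1})) ^^ k) f"

definition C_diff :: "nat \<Rightarrow> (real \<Rightarrow> real) \<Rightarrow> bool" where
  "C_diff k f \<longleftrightarrow>
     (\<forall>j<k. \<forall>x\<in>{-1..1}. nderiv j f differentiable (at x within {-1..1})) \<and>
     continuous_on {-1..1} (nderiv k f)"

definition sup_norm :: "(real \<Rightarrow> real) \<Rightarrow> real" where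
  "sup_norm g = (SUP x\<in>{-1..1}. \<bar>g x\<bar>)"


definition equispaced :: "nat \<Rightarrow> real set" where
  "equispaced n = {-1 + 2 / real n * real i | i. i \<le> n}"

text \<open>
  Any equispaced grid of \<open>q\<close> points in the open interval is admitted, so that both the grid
  \<open>-1 + 2 (i+1) / (q+1)\<close> and the grid of midpoints \<open>-1 + (2 i+1) / q\<close> are covered.
\<close>

definition internal_equispaced :: "nat \<Rightarrow> (nat \<Rightarrow> real) \<Rightarrow> bool" where
  "internal_equispaced q t \<longleftrightarrow>
     (\<exists>a h. h > 0 \<and> (\<forall>i<q. t i = a + real i * h)) \<and> (\<forall>i<q. -1 < t i \<and> t i < 1)"

text \<open>\<open>closest G c y\<close>: the point \<open>y\<close> is a (in case of a tie, one of the two) nearest point of \<open>G\<close> to \<open>c\<close>.\<close>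

definition closest :: "real set \<Rightarrow> real \<Rightarrow> real \<Rightarrow> bool" where
  "closest G c y \<longleftrightarrow> is_arg_min (\<lambda>z. dist z c) (\<lambda>z. z \<in> G) y"

definition adjacent :: "real set \<Rightarrow> real \<Rightarrow> real \<Rightarrow> bool" where
  "adjacent G y z \<longleftrightarrow> y \<in> G \<and> z \<in> G \<and> y \<noteq> z \<and> \<not> (\<exists>w\<in>G. min y z < w \<and> w < max y z)"

text \<open>
  The points \<open>c k\<close> (\<open>k \<in> I\<close>) are mimicked by pairwise distinct points \<open>x k\<close> of \<open>G\<close>: \<open>x k\<close> is the
  point of \<open>G\<close> closest to \<open>c k\<close>, except that a neighbour in \<open>G\<close> of the closest point is taken when
  this is necessary for distinctness, i.e. when the closest point already serves another index.
\<close>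

definition mimics :: "real set \<Rightarrow> nat set \<Rightarrow> (nat \<Rightarrow> real) \<Rightarrow> (nat \<Rightarrow> real) \<Rightarrow> bool" where
  "mimics G I c x \<longleftrightarrow> inj_on x I \<and>
     (\<forall>k\<in>I. x k \<in> G \<and>
        (closest G (c k) (x k) \<or>
         (\<forall>y. closest G (c k) y \<longrightarrow> y \<in> x ` (I - {k})) \<and>
         (\<exists>y. closest G (c k) y \<and> adjacent G y (x k))))"

definition mock_chebyshev :: "real set \<Rightarrow> nat \<Rightarrow> (nat \<Rightarrow> real) \<Rightarrow> bool" where
  "mock_chebyshev G m x \<longleftrightarrow> mimics G {..m} (\<lambda>k. - cos (real k * pi / real m)) x"


definition chebyshev_T :: "nat \<Rightarrow> real \<Rightarrow> real" where
  "chebyshev_T k x = cos (real k * arccos x)"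

definition cheb_mat :: "nat \<Rightarrow> nat \<Rightarrow> (nat \<Rightarrow> real) \<Rightarrow> real mat" where
  "cheb_mat k r x = Matrix.mat (k + 1) (r + 1) (\<lambda>(i, j). chebyshev_T j (x i))"

definition kkt_mat :: "nat \<Rightarrow> nat \<Rightarrow> nat \<Rightarrow> (nat \<Rightarrow> real) \<Rightarrow> real mat" where
  "kkt_mat n m r x =
     (let V = cheb_mat n r x; C = cheb_mat m r x
      in four_block_mat (2 \<cdot>\<^sub>m (transpose_mat V * V)) (transpose_mat C) C (0\<^sub>m (m + 1) (m + 1)))"

definition kkt_rhs :: "nat \<Rightarrow> nat \<Rightarrow> nat \<Rightarrow> (nat \<Rightarrow> real) \<Rightarrow> (real \<Rightarrow> real) \<Rightarrow> real vec" where
  "kkt_rhs n m r x f =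
     (let b = Matrix.vec (n + 1) (\<lambda>i. f (x i)); d = Matrix.vec (m + 1) (\<lambda>i. f (x i))
      in (2 \<cdot>\<^sub>v (transpose_mat (cheb_mat n r x) *\<^sub>v b)) @\<^sub>v d)"

definition kkt_sol :: "nat \<Rightarrow> nat \<Rightarrow> nat \<Rightarrow> (nat \<Rightarrow> real) \<Rightarrow> (real \<Rightarrow> real) \<Rightarrow> real vec" where
  "kkt_sol n m r x f =
     (THE s. s \<in> carrier_vec ((r + 1) + (m + 1)) \<and> kkt_mat n m r x *\<^sub>v s = kkt_rhs n m r x f)"

text \<open>Only the first \<open>r + 1\<close> entries of the solution are coefficients; the rest are multipliers.\<close>

definition cmcls :: "nat \<Rightarrow> nat \<Rightarrow> nat \<Rightarrow> (nat \<Rightarrow> real) \<Rightarrow> (real \<Rightarrow> real) \<Rightarrow> real \<Rightarrow> real" where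
  "cmcls n m r x f t = (\<Sum>i\<le>r. vec_index (kkt_sol n m r x f) i * chebyshev_T i t)"


definition vec_norm1 :: "real vec \<Rightarrow> real" where
  "vec_norm1 v = (\<Sum>i<dim_vec v. \<bar>vec_index v i\<bar>)"

definition mat_norm1 :: "real mat \<Rightarrow> real" where
  "mat_norm1 A = (SUP v\<in>{v \<in> carrier_vec (dim_col A). vec_norm1 v = 1}. vec_norm1 (A *\<^sub>v v))"

lemma mat_norm1_eq_max_col_sum:
  assumes "dim_col A > 0"
  shows "mat_norm1 A = Max ((\<lambda>j. \<Sum>i<dim_row A. \<bar>A $$ (i, j)\<bar>) ` {..<dim_col A})"
    (is "_ = Max (?s ` ?J)")
  unfolding mat_norm1_def
proof (rule cSup_eq_maximum)
  have fin: "finite (?s ` ?J)" "?s ` ?J \<noteq> {}" using assms by auto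
  from Max_in[OF fin] obtain j where j: "j < dim_col A" "Max (?s ` ?J) = ?s j" by auto
  let ?u = "unit_vec (dim_col A) j :: real vec"
  have "vec_norm1 ?u = (\<Sum>i<dim_col A. if i = j then 1 else 0)"
    unfolding vec_norm1_def using j by (intro sum.cong) auto
  then have 1: "vec_norm1 ?u = 1" using j by simp
  have "vec_norm1 (A *\<^sub>v ?u) = ?s j"
    unfolding vec_norm1_def using j by (intro sum.cong) auto
  with 1 j show "Max (?s ` ?J) \<in>
      (\<lambda>v. vec_norm1 (A *\<^sub>v v)) ` {v \<in> carrier_vec (dim_col A). vec_norm1 v = 1}"
    by (intro image_eqI[of _ _ ?u]) auto
next
  fix y assume "y \<in> (\<lambda>v. vec_norm1 (A *\<^sub>v v)) ` {v \<in> carrier_vec (dim_col A). vec_norm1 v = 1}"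
  then obtain v where v: "v \<in> carrier_vec (dim_col A)" "vec_norm1 v = 1"
    and y: "y = vec_norm1 (A *\<^sub>v v)" by auto
  have "y = (\<Sum>i<dim_row A. \<bar>\<Sum>j<dim_col A. A $$ (i, j) * vec_index v j\<bar>)"
    unfolding y vec_norm1_def using v(1)
    by (auto simp: scalar_prod_def atLeast0LessThan intro!: sum.cong arg_cong[where f = abs])
  also have "\<dots> \<le> (\<Sum>i<dim_row A. \<Sum>j<dim_col A. \<bar>A $$ (i, j)\<bar> * \<bar>vec_index v j\<bar>)"
    by (intro sum_mono order_trans[OF sum_abs]) (simp add: abs_mult)
  also have "\<dots> = (\<Sum>j<dim_col A. ?s j * \<bar>vec_index v j\<bar>)"
    by (subst sum.swap) (simp add: sum_distrib_right)
  also have "\<dots> \<le> (\<Sum>j<dim_col A. Max (?s ` ?J) * \<bar>vec_index v j\<bar>)"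
    by (intro sum_mono mult_right_mono Max_ge) auto
  also have "\<dots> = Max (?s ` ?J) * vec_norm1 v"
    using v(1) by (auto simp: vec_norm1_def sum_distrib_left)
  finally show "y \<le> Max (?s ` ?J)" using v(2) by simp
qed

text \<open>The value is only meaningful for nonsingular \<open>A\<close>, where \<open>mat_inverse A\<close> is not \<open>None\<close>.\<close>

definition mat_inv :: "real mat \<Rightarrow> real mat" where
  "mat_inv A = the (mat_inverse A)"

definition cond1 :: "real mat \<Rightarrow> real" where
  "cond1 A = mat_norm1 A * mat_norm1 (mat_inv A)"

definition B_const :: "nat \<Rightarrow> nat \<Rightarrow> real mat \<Rightarrow> real" where
  "B_const m r M = 2 * real (r + 1) * cond1 M + real (m + 1) * mat_norm1 (mat_inv M)"


definition omega_poly :: "nat \<Rightarrow> nat \<Rightarrow> (nat \<Rightarrow> real) \<Rightarrow> (nat \<Rightarrow> real) \<Rightarrow> real \<Rightarrow> real" where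
  "omega_poly m p x1 x3 t = (\<Prod>k\<le>m. t - x1 k) * (\<Prod>s\<le>p. t - x3 s)"

definition ell_poly ::
  "nat \<Rightarrow> nat \<Rightarrow> (nat \<Rightarrow> real) \<Rightarrow> (nat \<Rightarrow> real) \<Rightarrow> nat \<Rightarrow> real \<Rightarrow> real" where
  "ell_poly m p x1 x3 j t =
     (\<Prod>k\<le>m. (t - x1 k) / (x3 j - x1 k)) * (\<Prod>s\<in>{..p} - {j}. (t - x3 s) / (x3 j - x3 s))"

end

theory Submission
  imports Defs "Jordan_Normal_Form.Determinant"
begin

text \<open>
  No Markov inequality and no Jackson theorem is needed, because the comparison polynomial may be
  adapted to \<open>\<nu>\<close>. Let \<open>q\<close> be the polynomial of degree \<open>\<le> r\<close> for which \<open>g = f - q\<close> satisfies: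
  \<open>g\<close> vanishes at the zeros of \<open>T\<^sub>\<nu>\<close>, \<open>g\<^bsup>(\<nu>)\<^esup>\<close> vanishes at the \<open>r - \<nu>\<close> zeros of \<open>T\<^bsub>r-\<nu>\<^esub>\<close>, and
  \<open>g\<^bsup>(r)\<^esup> = f\<^bsup>(r)\<^esup> - f\<^bsup>(r)\<^esup>(0)\<close>. Since the operator reproduces \<open>q\<close>, the error of \<open>f\<close> is \<open>g\<close> minus the
  approximant of \<open>g\<close>.

  By Rolle's theorem, \<open>g\<^bsup>(\<nu>)\<^esup>\<close> is at most \<open>2\<^bsup>1-r+\<nu>\<^esup> / (r-\<nu>)!\<close> times the norm of \<open>f\<^bsup>(r+1)\<^esup>\<close>, and this is
  below the first term because the monic polynomial \<open>\<omega>\<^sub>r\<close> of degree \<open>r + 1\<close> has norm at least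
  \<open>2\<^bsup>-r\<^esup>\<close>. Likewise \<open>g\<close> itself is at most \<open>4 / r!\<close> times the norm of \<open>f\<^bsup>(r)\<^esup>\<close>. The Chebyshev
  coefficients of the approximant of \<open>g\<close> have absolute sum at most \<open>B\<^sub>n\<close> times the norm of \<open>g\<close>, and the
  \<open>\<nu>\<close>-th derivative of each \<open>T\<^sub>i\<close>, \<open>i \<le> r\<close>, is at most its value at \<open>1\<close> for \<open>i = r\<close>, which is the product
  in the second term. Finally \<open>4 (r + 1) \<le> (\<pi>/2)\<^sup>r\<close>, since \<open>r \<le> n\<close> forces \<open>r \<ge> 8\<close>.
\<close>

hide_const (open) Module.smult

subsection \<open>Smooth functions on the interval, Rolle, interpolation\<close>

text \<open>A function is carried together with its derivatives \<open>F 0\<close>, ...,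
  \<open>F k\<close>, one-sided at the end points. Differences, multiples and shifts of chains are
  chains again, so \<open>nderiv\<close> is unfolded only at the interface.\<close>

definition deriv_chain :: "nat \<Rightarrow> (nat \<Rightarrow> real \<Rightarrow> real) \<Rightarrow> bool" where
  "deriv_chain k F \<longleftrightarrow>
     (\<forall>j<k. \<forall>x\<in>{-1..1}. (F j has_real_derivative F (Suc j) x) (at x within {-1..1}))"

lemma deriv_chainD:
  "\<lbrakk>deriv_chain k F; j < k; -1 \<le> x; x \<le> 1\<rbrakk> \<Longrightarrow>
     (F j has_real_derivative F (Suc j) x) (at x within {-1..1})"
  by (simp add: deriv_chain_def)

lemma deriv_chain_mono: "\<lbrakk>deriv_chain k F; l \<le> k\<rbrakk> \<Longrightarrow> deriv_chain l F"
  by (simp add: deriv_chain_def)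

lemma deriv_chain_shift: "deriv_chain (k + l) F \<Longrightarrow> deriv_chain l (\<lambda>j. F (k + j))"
  by (simp add: deriv_chain_def)

lemma deriv_chain_diff:
  "\<lbrakk>deriv_chain k F; deriv_chain k G\<rbrakk> \<Longrightarrow> deriv_chain k (\<lambda>j x. F j x - G j x)"
  by (auto simp: deriv_chain_def intro!: DERIV_diff)

lemma deriv_chain_scale:
  "deriv_chain k F \<Longrightarrow> deriv_chain k (\<lambda>j x. F j x * c)"
  by (auto simp: deriv_chain_def intro!: DERIV_cmult_right)

lemma deriv_chain_poly: "deriv_chain k (\<lambda>j. poly ((pderiv ^^ j) p))"
  by (auto simp: deriv_chain_def intro!: has_field_derivative_at_within[OF poly_DERIV])

lemma deriv_chain_continuous:
  assumes "deriv_chain k F" "j < k"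
  shows "continuous_on {-1..1} (F j)"
  by (rule DERIV_continuous_on[where D = "F (Suc j)"]) (use assms deriv_chainD in auto)

lemma nderiv_Suc:
  "nderiv (Suc j) f x = vector_derivative (nderiv j f) (at x within {-1..1})"
  by (simp add: nderiv_def)

text \<open>Derivatives within a nondegenerate closed interval are unique, so any chain that starts
  with the values of \<open>g\<close> on [-1,1] computes its \<open>nderiv\<close>.\<close>

lemma nderiv_deriv_chain:
  assumes F: "deriv_chain k F" and eq: "\<And>x. x \<in> {-1..1} \<Longrightarrow> g x = F 0 x"
  shows "\<lbrakk>j \<le> k; x \<in> {-1..1}\<rbrakk> \<Longrightarrow> nderiv j g x = F j x"
proof (induction j arbitrary: x)
  case 0
  then show ?case using eq by (simp add: nderiv_def)
next
  case (Suc j)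
  have "(F j has_vector_derivative F (Suc j) x) (at x within {-1..1})"
    using deriv_chainD[OF F, of j x] Suc.prems
    by (simp add: has_real_derivative_iff_has_vector_derivative)
  then have "(nderiv j g has_vector_derivative F (Suc j) x) (at x within {-1..1})"
    by (rule has_vector_derivative_transform[rotated 2]) (use Suc in auto)
  then show ?case
    unfolding nderiv_Suc using Suc.prems
    by (intro vector_derivative_within_closed_interval) auto
qed

lemma C_diff_deriv_chain: "C_diff k f \<Longrightarrow> deriv_chain k (\<lambda>j. nderiv j f)"
  unfolding C_diff_def deriv_chain_def has_real_derivative_iff_has_vector_derivative nderiv_Suc
  using vector_derivative_works by blast

lemma abs_le_sup_norm:
  assumes "continuous_on {-1..1} g" "-1 \<le> x" "x \<le> 1"
  shows "\<bar>g x\<bar> \<le> sup_norm g"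
proof -
  have "compact ((\<lambda>x. \<bar>g x\<bar>) ` {-1..1})"
    using assms(1) by (intro compact_continuous_image continuous_intros) auto
  then have "bdd_above ((\<lambda>x. \<bar>g x\<bar>) ` {-1..1})"
    by (intro bounded_imp_bdd_above compact_imp_bounded)
  then show ?thesis
    unfolding sup_norm_def using assms(2,3) by (intro cSUP_upper) auto
qed

lemma sup_norm_le: "(\<And>x. \<lbrakk>-1 \<le> x; x \<le> 1\<rbrakk> \<Longrightarrow> \<bar>g x\<bar> \<le> C) \<Longrightarrow> sup_norm g \<le> C"
  unfolding sup_norm_def by (intro cSUP_least) auto

lemma sup_norm_cong: "(\<And>x. x \<in> {-1..1} \<Longrightarrow> g x = h x) \<Longrightarrow> sup_norm g = sup_norm h"
  unfolding sup_norm_def by (intro SUP_cong) auto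

section \<open>Counting zeros with Rolle's theorem\<close>

text \<open>Induction that removes the largest zero: Rolle between the two largest zeros adds a zero
  to the right of all those given by the induction hypothesis. Locating the zeros strictly between
  \<open>Min Z\<close> and \<open>Max Z\<close> keeps the new one distinct.\<close>

lemma Rolle_zeros:
  assumes F: "deriv_chain (Suc 0) F"
    and Z: "finite Z" "Z \<subseteq> {-1..1}" "card Z = Suc n" "\<And>z. z \<in> Z \<Longrightarrow> F 0 z = 0"
  shows "\<exists>Z'. finite Z' \<and> Z' \<subseteq> {Min Z<..<Max Z} \<and> card Z' = n \<and> (\<forall>z\<in>Z'. F 1 z = 0)"
  using Z
proof (induction n arbitrary: Z)
  case 0
  then show ?case by (intro exI[of _ "{}"]) auto
next
  case (Suc n)
  define b where "b = Max Z"
  define Z0 where "Z0 = Z - {b}"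
  have "Z \<noteq> {}" using Suc.prems by auto
  then have b: "b \<in> Z" using Suc.prems by (simp add: b_def)
  have Z0: "finite Z0" "Z0 \<subseteq> {-1..1}" "card Z0 = Suc n" "\<And>z. z \<in> Z0 \<Longrightarrow> F 0 z = 0"
    using Suc.prems b by (auto simp: Z0_def)
  have ne: "Z0 \<noteq> {}" using Z0 by auto
  define a where "a = Max Z0"
  have a: "a \<in> Z0" unfolding a_def using Z0 ne by simp
  have "a \<le> b" unfolding b_def using a Suc.prems by (intro Max_ge) (auto simp: Z0_def)
  moreover have "a \<noteq> b" using a by (auto simp: Z0_def)
  ultimately have ab: "a < b" by simp
  have le: "Min Z \<le> Min Z0" using ne Suc.prems by (intro Min_antimono) (auto simp: Z0_def)
  obtain Z' where Z': "finite Z'" "Z' \<subseteq> {Min Z0<..<a}" "card Z' = n" "\<forall>z\<in>Z'. F 1 z = 0"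
    using Suc.IH[OF Z0] unfolding a_def by auto
  have ab1: "a \<ge> -1" "b \<le> 1" using a b Z0 Suc.prems by auto
  have "continuous_on {-1..1} (F 0)" by (rule deriv_chain_continuous[OF F]) simp
  then have cont: "continuous_on {a..b} (F 0)"
    by (rule continuous_on_subset) (use ab1 in auto)
  \<comment> \<open>Points strictly between \<open>a\<close> and \<open>b\<close> are interior to
    [-1,1], so the derivative there is two-sided, as Rolle requires.\<close>
  have der: "(F 0 has_derivative (*) (F 1 x)) (at x)" if "a < x" "x < b" for x
    using deriv_chainD[OF F, of 0 x] ab1 that
    by (simp add: has_field_derivative_def at_within_Icc_at)
  obtain c where c: "a < c" "c < b" "(*) (F 1 c) = (\<lambda>v. 0)"
    using Rolle_deriv[OF ab _ cont der] Z0(4)[OF a] Suc.prems(4)[OF b] by auto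
  have "F 1 c = 0" using fun_cong[OF c(3), of 1] by simp
  moreover have "Min Z \<le> a" using le Min_le[OF Z0(1) a] by linarith
  moreover have "c \<notin> Z'" using Z' c by force
  ultimately show ?case using Z' c ab le
    by (intro exI[of _ "insert c Z'"]) (auto simp: b_def[symmetric])
qed

lemma Rolle_iterated:
  assumes "deriv_chain k F"
    and "finite Z" "Z \<subseteq> {-1..1}" "card Z = Suc k" "\<And>z. z \<in> Z \<Longrightarrow> F 0 z = 0"
  shows "\<exists>\<xi>\<in>{-1..1}. F k \<xi> = 0"
  using assms
proof (induction k arbitrary: F Z)
  case 0
  then obtain z where "z \<in> Z" by fastforce
  with 0 show ?case by blast
next
  case (Suc k)
  obtain Z' where Z': "finite Z'" "Z' \<subseteq> {Min Z<..<Max Z}" "card Z' = Suc k"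
      "\<forall>z\<in>Z'. F 1 z = 0"
    using Rolle_zeros[OF deriv_chain_mono[OF Suc.prems(1)] Suc.prems(2-5)] by auto
  have "Min Z \<in> Z" "Max Z \<in> Z" using Suc.prems by (auto intro!: Min_in Max_in)
  then have "Z' \<subseteq> {-1..1}" using Z'(2) Suc.prems(3) by fastforce
  then have "\<exists>\<xi>\<in>{-1..1}. (\<lambda>j. F (1 + j)) k \<xi> = 0"
    using Z' Suc.prems(1) by (intro Suc.IH[of "\<lambda>j. F (1 + j)" Z'] deriv_chain_shift) auto
  then show ?case by simp
qed

lemma pderiv_iterate_degree:
  "degree W \<le> k \<Longrightarrow> (pderiv ^^ k) W = [:fact k * coeff W k:]" for W :: "real poly"
proof (induction k arbitrary: W)
  case 0
  then show ?case by (simp add: degree_0_id[symmetric])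
next
  case (Suc k)
  have "(pderiv ^^ Suc k) W = (pderiv ^^ k) (pderiv W)" by (simp add: funpow_swap1)
  also have "\<dots> = [:fact k * coeff (pderiv W) k:]"
    using Suc.prems by (intro Suc.IH) (simp add: degree_pderiv)
  finally show ?case by (simp add: coeff_pderiv algebra_simps)
qed

text \<open>The classical interpolation error argument: \<open>G 0\<close> vanishes at
  \<open>x\<close> and on \<open>Z\<close>, hence at \<open>k + 1\<close> points, so its k-th
  derivative has a zero; there the k-th derivative of \<open>W\<close> is the constant
  \<open>fact k * coeff W k\<close>. \<open>W\<close> need not be monic, which allows it to be a
  Chebyshev polynomial.\<close>

lemma vanishing_bound:
  assumes F: "deriv_chain k F"
    and W: "degree W \<le> k" "coeff W k > 0"
    and Z: "finite Z" "Z \<subseteq> {-1..1}" "card Z = k"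
      "\<And>z. z \<in> Z \<Longrightarrow> F 0 z = 0" "\<And>z. z \<in> Z \<Longrightarrow> poly W z = 0"
    and C: "\<And>y. \<lbrakk>-1 \<le> y; y \<le> 1\<rbrakk> \<Longrightarrow> \<bar>F k y\<bar> \<le> C"
    and x: "-1 \<le> x" "x \<le> 1"
  shows "\<bar>F 0 x\<bar> \<le> \<bar>poly W x\<bar> * C / (fact k * coeff W k)"
proof (cases "x \<in> Z")
  case True
  then show ?thesis using Z by simp
next
  case False
  define G where "G j y = F j y * poly W x - poly ((pderiv ^^ j) W) y * F 0 x" for j y
  have "deriv_chain k G"
    unfolding G_def by (intro deriv_chain_diff deriv_chain_scale F deriv_chain_poly)
  moreover have "G 0 z = 0" if "z \<in> insert x Z" for z
    using that Z by (auto simp: G_def)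
  ultimately obtain \<xi> where \<xi>: "\<xi> \<in> {-1..1}" "G k \<xi> = 0"
    using Rolle_iterated[of k G "insert x Z"] False Z(1-3) x by auto
  have "fact k * coeff W k * F 0 x = F k \<xi> * poly W x"
    using \<xi>(2) by (simp add: G_def pderiv_iterate_degree[OF W(1)])
  then have "fact k * coeff W k * \<bar>F 0 x\<bar> = \<bar>F k \<xi>\<bar> * \<bar>poly W x\<bar>"
    using W(2) by (metis abs_mult abs_of_pos fact_gt_zero mult_pos_pos)
  also have "\<dots> \<le> C * \<bar>poly W x\<bar>" using \<xi> C by (intro mult_right_mono) auto
  finally show ?thesis using W(2) by (simp add: field_simps)
qed

text \<open>Newton's form: each new node adds a multiple of the node polynomial of the earlier ones.
  The first two clauses express "degree less than \<open>card Z\<close>" without truncated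
  subtraction.\<close>

lemma poly_interpolation:
  fixes h :: "real \<Rightarrow> real"
  assumes "finite Z"
  shows "\<exists>p. (\<forall>n. card Z \<le> Suc n \<longrightarrow> degree p \<le> n) \<and> (Z = {} \<longrightarrow> p = 0) \<and> (\<forall>z\<in>Z. poly p z = h z)"
  using assms
proof (induction Z)
  case empty
  then show ?case by (intro exI[of _ 0]) auto
next
  case (insert z Z)
  then obtain p where p: "\<forall>n. card Z \<le> Suc n \<longrightarrow> degree p \<le> n" "\<forall>z\<in>Z. poly p z = h z" by auto
  define w where "w = (\<Prod>a\<in>Z. [:-a, 1:])"
  have w: "poly w z \<noteq> 0" "\<And>a. a \<in> Z \<Longrightarrow> poly w a = 0" "degree w = card Z"
    using insert by (auto simp: w_def poly_prod degree_prod_eq_sum_degree)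
  define c where "c = (h z - poly p z) / poly w z"
  have deg: "degree (p + smult c w) \<le> card Z"
    using p(1) w(3) by (intro degree_add_le order_trans[OF degree_smult_le]) auto
  have "poly (p + smult c w) z = h z" using w(1) by (simp add: c_def)
  moreover have "poly (p + smult c w) a = h a" if "a \<in> Z" for a
    using p(2) w(2) that by simp
  ultimately show ?case using deg insert.hyps
    by (intro exI[of _ "p + smult c w"]) auto
qed

lemma poly_antiderivative:
  "\<exists>P. (pderiv ^^ k) P = p \<and> degree P \<le> degree p + k" for p :: "real poly"
proof (induction k arbitrary: p)
  case 0
  then show ?case by auto
next
  case (Suc k)
  define P where "P = (\<Sum>i\<le>degree p. monom (coeff p i / real (Suc i)) (Suc i))"
  have "pderiv P = (\<Sum>i\<le>degree p. monom (coeff p i) i)"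
    unfolding P_def by (simp add: higher_pderiv_sum[of 1, simplified] pderiv_monom)
  then have P: "pderiv P = p" by (simp add: poly_as_sum_of_monoms)
  have dP: "degree P \<le> Suc (degree p)"
    unfolding P_def by (intro degree_sum_le) (auto intro!: order_trans[OF degree_monom_le])
  obtain Q where Q: "(pderiv ^^ k) Q = P" "degree Q \<le> degree P + k" using Suc by blast
  then show ?case using P dP by (intro exI[of _ Q]) auto
qed

subsection \<open>Chebyshev polynomials\<close>

text \<open>Three-term recurrence for T_n. It gives a genuine polynomial, whereas
  \<open>chebyshev_T\<close> is tied to \<open>arccos\<close> and is used as a polynomial on [-1,1]
  only.\<close>

fun cheb_poly :: "nat \<Rightarrow> real poly" where
  "cheb_poly 0 = 1"
| "cheb_poly (Suc 0) = [:0, 1:]"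
| "cheb_poly (Suc (Suc n)) = [:0, 2:] * cheb_poly (Suc n) - cheb_poly n"

lemma cheb_poly_cos: "poly (cheb_poly n) (cos \<theta>) = cos (real n * \<theta>)"
proof (induction n rule: cheb_poly.induct)
  case (3 n)
  have "cos (real (Suc (Suc n)) * \<theta>) + cos (real n * \<theta>) =
      cos (real (Suc n) * \<theta> + \<theta>) + cos (real (Suc n) * \<theta> - \<theta>)"
    by (simp add: algebra_simps)
  also have "\<dots> = 2 * cos \<theta> * cos (real (Suc n) * \<theta>)"
    unfolding cos_add cos_diff by simp
  finally show ?case using 3 by simp
qed auto

lemma chebyshev_T_poly: "\<lbrakk>-1 \<le> x; x \<le> 1\<rbrakk> \<Longrightarrow> chebyshev_T n x = poly (cheb_poly n) x"
  using cheb_poly_cos[of n "arccos x"] by (simp add: chebyshev_T_def)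

text \<open>Truncated subtraction makes \<open>2 ^ (n - 1)\<close> correct for \<open>n = 0\<close>
  as well, where the coefficient is 1.\<close>

lemma cheb_poly_degree_coeff:
  "degree (cheb_poly n) \<le> n \<and> coeff (cheb_poly n) n = 2 ^ (n - 1)"
proof (induction n rule: cheb_poly.induct)
  case (3 n)
  have "degree ([:0, 2:] * cheb_poly (Suc n)) \<le> Suc (Suc n)"
    using 3 by (intro order_trans[OF degree_mult_le]) auto
  moreover have "degree (cheb_poly n) \<le> Suc (Suc n)" using 3 by simp
  moreover have "coeff (cheb_poly n) (Suc (Suc n)) = 0"
    using 3 by (intro coeff_eq_0) auto
  ultimately show ?case using 3 by (auto intro: degree_diff_le)
qed auto

lemmas cheb_poly_degree = cheb_poly_degree_coeff[THEN conjunct1]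
  and cheb_poly_coeff = cheb_poly_degree_coeff[THEN conjunct2]

text \<open>The cosine maps (0, pi) onto the infinite set (-1,1). The end points are left out so
  that \<open>sin \<theta>\<close> may be cancelled.\<close>

lemma poly_eqI_cos:
  assumes "\<And>\<theta>. \<lbrakk>0 < \<theta>; \<theta> < pi\<rbrakk> \<Longrightarrow> poly p (cos \<theta>) = poly q (cos \<theta>)"
  shows "p = (q :: real poly)"
proof (rule ccontr)
  assume "p \<noteq> q"
  then have "finite {x. poly (p - q) x = 0}" by (intro poly_roots_finite) simp
  moreover have "{-1<..<1} \<subseteq> {x. poly (p - q) x = 0}"
  proof
    fix x :: real assume "x \<in> {-1<..<1}"
    then show "x \<in> {x. poly (p - q) x = 0}"
      using assms[of "arccos x"] arccos_lt_bounded[of x] by simp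
  qed
  ultimately have "finite {-1<..<1::real}" by (rule finite_subset[rotated])
  then show False by (simp add: infinite_Ioo)
qed

section \<open>Differential identities for Chebyshev polynomials\<close>

lemma cheb_poly_deriv_sin:
  "sin \<theta> * poly (pderiv (cheb_poly n)) (cos \<theta>) = real n * sin (real n * \<theta>)"
proof -
  have "((\<lambda>\<theta>. poly (cheb_poly n) (cos \<theta>)) has_real_derivative
      poly (pderiv (cheb_poly n)) (cos \<theta>) * - sin \<theta>) (at \<theta>)"
    by (rule DERIV_chain2[OF poly_DERIV]) (auto intro!: derivative_eq_intros)
  moreover have "((\<lambda>\<theta>. poly (cheb_poly n) (cos \<theta>)) has_real_derivative
      - (real n * sin (real n * \<theta>))) (at \<theta>)"
    unfolding cheb_poly_cos by (auto intro!: derivative_eq_intros)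
  ultimately have "poly (pderiv (cheb_poly n)) (cos \<theta>) * - sin \<theta> = - (real n * sin (real n * \<theta>))"
    by (rule DERIV_unique)
  then show ?thesis by (simp add: mult.commute)
qed

text \<open>This is T'_{n+2}/(n+2) = 2 T_{n+1} + T'_n/n with denominators cleared. For
  \<open>n > 0\<close> it writes T'_{n+2} with nonnegative coefficients.\<close>

lemma cheb_poly_deriv_rec:
  "smult (real n) (pderiv (cheb_poly (Suc (Suc n)))) =
     smult (2 * real n * (real n + 2)) (cheb_poly (Suc n)) + smult (real n + 2) (pderiv (cheb_poly n))"
proof (rule poly_eqI_cos)
  fix \<theta> :: real assume "0 < \<theta>" "\<theta> < pi"
  then have s: "sin \<theta> \<noteq> 0" using sin_gt_zero by force
  have "sin (real (Suc (Suc n)) * \<theta>) - sin (real n * \<theta>) =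
      sin (real (Suc n) * \<theta> + \<theta>) - sin (real (Suc n) * \<theta> - \<theta>)"
    by (simp add: algebra_simps)
  also have "\<dots> = 2 * cos (real (Suc n) * \<theta>) * sin \<theta>"
    unfolding sin_add sin_diff by simp
  finally have *: "sin (real (Suc (Suc n)) * \<theta>) =
      2 * cos (real (Suc n) * \<theta>) * sin \<theta> + sin (real n * \<theta>)" by simp
  have "sin \<theta> * (real n * poly (pderiv (cheb_poly (Suc (Suc n)))) (cos \<theta>)) =
      real n * (real (Suc (Suc n)) * sin (real (Suc (Suc n)) * \<theta>))"
    by (metis cheb_poly_deriv_sin mult.left_commute)
  also have "\<dots> = sin \<theta> * (2 * real n * (real n + 2) * cos (real (Suc n) * \<theta>)) +
      (real n + 2) * (real n * sin (real n * \<theta>))"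
    unfolding * by (simp add: algebra_simps)
  also have "\<dots> = sin \<theta> * (2 * real n * (real n + 2) * cos (real (Suc n) * \<theta>) +
      (real n + 2) * poly (pderiv (cheb_poly n)) (cos \<theta>))"
    by (simp only: distrib_left mult.left_commute[of "sin \<theta>" "real n + 2"] cheb_poly_deriv_sin)
  finally show "poly (smult (real n) (pderiv (cheb_poly (Suc (Suc n))))) (cos \<theta>) =
      poly (smult (2 * real n * (real n + 2)) (cheb_poly (Suc n)) +
        smult (real n + 2) (pderiv (cheb_poly n))) (cos \<theta>)"
    unfolding mult_left_cancel[OF s] by (simp only: poly_add poly_smult cheb_poly_cos)
qed

text \<open>Chebyshev's differential equation, with \<open>[:1, 0, -1:]\<close> standing for 1 -
  x^2; it results from differentiating \<open>cheb_poly_deriv_sin\<close> once more in the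
  angle.\<close>

lemma cheb_poly_ode:
  "smult ((real n)\<^sup>2) (cheb_poly n) =
     [:0, 1:] * pderiv (cheb_poly n) - [:1, 0, -1:] * pderiv (pderiv (cheb_poly n))"
proof (rule poly_eqI_cos)
  fix \<theta> :: real
  let ?p = "pderiv (cheb_poly n)"
  have "((\<lambda>\<theta>. poly ?p (cos \<theta>)) has_real_derivative poly (pderiv ?p) (cos \<theta>) * - sin \<theta>) (at \<theta>)"
    by (rule DERIV_chain2[OF poly_DERIV]) (auto intro!: derivative_eq_intros)
  from DERIV_mult[OF DERIV_sin this]
  have "((\<lambda>\<theta>. sin \<theta> * poly ?p (cos \<theta>)) has_real_derivative
      cos \<theta> * poly ?p (cos \<theta>) + poly (pderiv ?p) (cos \<theta>) * - sin \<theta> * sin \<theta>) (at \<theta>)" .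
  moreover have "((\<lambda>\<theta>. sin \<theta> * poly ?p (cos \<theta>)) has_real_derivative
      (real n)\<^sup>2 * cos (real n * \<theta>)) (at \<theta>)"
    unfolding cheb_poly_deriv_sin
    by (auto intro!: derivative_eq_intros simp: power2_eq_square)
  ultimately have "cos \<theta> * poly ?p (cos \<theta>) + poly (pderiv ?p) (cos \<theta>) * - sin \<theta> * sin \<theta> =
      (real n)\<^sup>2 * cos (real n * \<theta>)"
    by (rule DERIV_unique)
  moreover have "poly (pderiv ?p) (cos \<theta>) * (sin \<theta> * sin \<theta>) =
      poly (pderiv ?p) (cos \<theta>) * (1 - cos \<theta> * cos \<theta>)"
    using sin_cos_squared_add[of \<theta>] by (simp add: power2_eq_square eq_diff_eq)
  ultimately show "poly (smult ((real n)\<^sup>2) (cheb_poly n)) (cos \<theta>) =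
      poly ([:0, 1:] * ?p - [:1, 0, -1:] * pderiv ?p) (cos \<theta>)"
    by (simp add: cheb_poly_cos algebra_simps)
qed

text \<open>Chebyshev's equation differentiated \<open>j\<close> times. At 1 the coefficient 1 - x^2
  vanishes, which leaves a first-order recursion in \<open>j\<close> for the derivatives at
  1.\<close>

lemma cheb_poly_deriv_ode:
  "smult ((real n)\<^sup>2 - (real j)\<^sup>2) ((pderiv ^^ j) (cheb_poly n)) =
     smult (2 * real j + 1) ([:0, 1:] * (pderiv ^^ Suc j) (cheb_poly n)) -
     [:1, 0, -1:] * (pderiv ^^ Suc (Suc j)) (cheb_poly n)"
proof (induction j)
  case 0
  then show ?case using cheb_poly_ode[of n] by simp
next
  case (Suc j)
  let ?D = "\<lambda>i. (pderiv ^^ i) (cheb_poly n)"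
  have "smult ((real n)\<^sup>2 - (real j)\<^sup>2) (?D (Suc j)) =
    pderiv (smult (2 * real j + 1) ([:0, 1:] * ?D (Suc j)) - [:1, 0, -1:] * ?D (Suc (Suc j)))"
    unfolding Suc[symmetric] by (simp add: pderiv_smult)
  also have "\<dots> = smult (2 * real j + 1) ([:0, 1:] * ?D (Suc (Suc j)) + ?D (Suc j)) -
     ([:1, 0, -1:] * ?D (Suc (Suc (Suc j))) + ?D (Suc (Suc j)) * [:0, -2:])"
  proof -
    have p: "pderiv [:0, 1:] = (1 :: real poly)" "pderiv [:1, 0, -1:] = ([:0, -2:] :: real poly)"
      by (simp_all add: pderiv_pCons)
    show ?thesis
      by (simp only: pderiv_diff pderiv_smult pderiv_mult p funpow.simps o_apply mult_1_right)
  qed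
  finally have eq: "smult ((real n)\<^sup>2 - (real j)\<^sup>2) (?D (Suc j)) = \<dots>" .
  show ?case
  proof (rule poly_ext)
    fix y
    have "poly (smult ((real n)\<^sup>2 - (real j)\<^sup>2) (?D (Suc j))) y =
      poly (smult (2 * real j + 1) ([:0, 1:] * ?D (Suc (Suc j)) + ?D (Suc j)) -
     ([:1, 0, -1:] * ?D (Suc (Suc (Suc j))) + ?D (Suc (Suc j)) * [:0, -2:])) y"
      by (simp only: eq)
    then show "poly (smult ((real n)\<^sup>2 - (real (Suc j))\<^sup>2) (?D (Suc j))) y =
      poly (smult (2 * real (Suc j) + 1) ([:0, 1:] * ?D (Suc (Suc j))) -
        [:1, 0, -1:] * ?D (Suc (Suc (Suc j)))) y"
      by (simp add: power2_eq_square algebra_simps)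
  qed
qed

lemma cheb_poly_deriv_at_1:
  "poly ((pderiv ^^ j) (cheb_poly n)) 1 =
     (\<Prod>i<j. (real n)\<^sup>2 - (real i)\<^sup>2) / (\<Prod>i<j. 2 * real i + 1)"
proof (induction j)
  case 0
  then show ?case using cheb_poly_cos[of n 0] by simp
next
  case (Suc j)
  have "poly (smult ((real n)\<^sup>2 - (real j)\<^sup>2) ((pderiv ^^ j) (cheb_poly n))) 1 =
     poly (smult (2 * real j + 1) ([:0, 1:] * (pderiv ^^ Suc j) (cheb_poly n)) -
     [:1, 0, -1:] * (pderiv ^^ Suc (Suc j)) (cheb_poly n)) 1"
    by (simp only: cheb_poly_deriv_ode)
  then have "((real n)\<^sup>2 - (real j)\<^sup>2) * poly ((pderiv ^^ j) (cheb_poly n)) 1 =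
     (2 * real j + 1) * poly ((pderiv ^^ Suc j) (cheb_poly n)) 1" by simp
  then have "poly ((pderiv ^^ Suc j) (cheb_poly n)) 1 =
     ((real n)\<^sup>2 - (real j)\<^sup>2) * poly ((pderiv ^^ j) (cheb_poly n)) 1 / (2 * real j + 1)"
    by (simp add: field_simps)
  then show ?case unfolding Suc by (simp add: field_simps)
qed

section \<open>Derivative bounds from nonnegative Chebyshev expansions\<close>

text \<open>Nonnegative combinations of Chebyshev polynomials. The class is closed under
  differentiation, and since T_i is at most T_i(1) = 1 in absolute value on [-1,1], each member is
  bounded there by its value at 1.\<close>

inductive cheb_cone :: "real poly \<Rightarrow> bool" where
  zero: "cheb_cone 0"
| add: "\<lbrakk>cheb_cone p; c \<ge> 0\<rbrakk> \<Longrightarrow> cheb_cone (p + smult c (cheb_poly i))"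

lemma cheb_cone_cheb_poly: "cheb_cone (cheb_poly i)"
  using cheb_cone.add[OF cheb_cone.zero, of 1 i] by simp

lemma cheb_cone_smult: "\<lbrakk>cheb_cone p; c \<ge> 0\<rbrakk> \<Longrightarrow> cheb_cone (smult c p)"
  by (induction rule: cheb_cone.induct) (auto simp: smult_add_right intro!: cheb_cone.intros)

lemma cheb_cone_add: "\<lbrakk>cheb_cone q; cheb_cone p\<rbrakk> \<Longrightarrow> cheb_cone (p + q)"
  by (induction rule: cheb_cone.induct) (auto simp: add.assoc[symmetric] intro!: cheb_cone.intros)

lemma cheb_cone_pderiv_cheb_poly: "cheb_cone (pderiv (cheb_poly n))"
proof (induction n rule: cheb_poly.induct)
  case 1
  then show ?case by (simp add: cheb_cone.zero)
next
  case 2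
  then show ?case using cheb_cone_cheb_poly[of 0] by (simp add: pderiv_pCons pCons_one)
next
  case (3 n)
  show ?case
  proof (cases "n = 0")
    case True
    \<comment> \<open>For \<open>n = 0\<close> the recurrence reads 0 = 0, so T_2' = 4 T_1 is
      computed directly.\<close>
    then have "pderiv (cheb_poly (Suc (Suc n))) = smult 4 (cheb_poly (Suc 0))"
      by (simp add: pderiv_diff pderiv_mult pderiv_pCons)
    then show ?thesis using cheb_cone_smult[OF cheb_cone_cheb_poly, of 4 "Suc 0"]
      by (simp only: zero_le_numeral)
  next
    case False
    have "pderiv (cheb_poly (Suc (Suc n))) =
       smult (1 / real n) (smult (real n) (pderiv (cheb_poly (Suc (Suc n)))))"
      using False by simp
    then show ?thesis unfolding cheb_poly_deriv_rec
      using 3 by (auto simp del: cheb_poly.simps smult_smult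
          intro!: cheb_cone_smult cheb_cone_add cheb_cone_cheb_poly)
  qed
qed

lemma cheb_cone_pderiv: "cheb_cone p \<Longrightarrow> cheb_cone (pderiv p)"
  by (induction rule: cheb_cone.induct)
    (auto simp: pderiv_add pderiv_smult
      intro!: cheb_cone.zero cheb_cone_add cheb_cone_smult cheb_cone_pderiv_cheb_poly)

lemma abs_cheb_poly_le_1: "\<lbrakk>-1 \<le> x; x \<le> 1\<rbrakk> \<Longrightarrow> \<bar>poly (cheb_poly n) x\<bar> \<le> 1"
  using cheb_poly_cos[of n "arccos x"] by simp

lemma cheb_cone_bound:
  assumes "cheb_cone p" "-1 \<le> x" "x \<le> 1"
  shows "\<bar>poly p x\<bar> \<le> poly p 1"
  using assms
proof (induction rule: cheb_cone.induct)
  case (add p c i)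
  have "\<bar>poly p x + c * poly (cheb_poly i) x\<bar> \<le> \<bar>poly p x\<bar> + \<bar>c * poly (cheb_poly i) x\<bar>"
    by (rule abs_triangle_ineq)
  also have "\<dots> \<le> poly p 1 + c * 1"
    using add abs_cheb_poly_le_1[of x i] by (auto simp: abs_mult mult_left_le intro!: add_mono)
  finally show ?case using cheb_poly_cos[of i 0] by simp
qed auto

lemma cheb_poly_deriv_bound:
  assumes "-1 \<le> x" "x \<le> 1"
  shows "\<bar>poly ((pderiv ^^ j) (cheb_poly n)) x\<bar> \<le> poly ((pderiv ^^ j) (cheb_poly n)) 1"
proof -
  have "cheb_cone ((pderiv ^^ j) (cheb_poly n))"
    by (induction j) (auto intro: cheb_cone_cheb_poly cheb_cone_pderiv)
  then show ?thesis using assms by (rule cheb_cone_bound)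
qed

text \<open>In the closed form every factor grows with the index, and all factors are nonnegative
  once \<open>j \<le> i\<close>; for \<open>i < j\<close> the smaller side contains the factor
  zero.\<close>

lemma cheb_poly_deriv_at_1_mono:
  assumes "i \<le> n"
  shows "poly ((pderiv ^^ j) (cheb_poly i)) 1 \<le> poly ((pderiv ^^ j) (cheb_poly n)) 1"
proof (cases "i < j")
  case True
  then have "(\<Prod>k<j. (real i)\<^sup>2 - (real k)\<^sup>2) = 0" by force
  then have "poly ((pderiv ^^ j) (cheb_poly i)) 1 = 0" by (simp add: cheb_poly_deriv_at_1)
  also have "0 \<le> \<bar>poly ((pderiv ^^ j) (cheb_poly n)) 1\<bar>" by simp
  also have "\<dots> \<le> poly ((pderiv ^^ j) (cheb_poly n)) 1" by (rule cheb_poly_deriv_bound) auto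
  finally show ?thesis .
next
  case False
  then show ?thesis unfolding cheb_poly_deriv_at_1
    using assms by (intro divide_right_mono prod_mono prod_nonneg) (auto intro!: power_mono)
qed

section \<open>Zeros and extremality of Chebyshev polynomials\<close>

definition cheb_nodes :: "nat \<Rightarrow> real set" where
  "cheb_nodes k = (\<lambda>i. cos (real (2 * i + 1) * pi / (2 * real k))) ` {..<k}"

lemma cheb_nodes: "finite (cheb_nodes k)" "cheb_nodes k \<subseteq> {-1..1}"
  by (auto simp: cheb_nodes_def)

lemma cheb_nodes_root: "z \<in> cheb_nodes k \<Longrightarrow> poly (cheb_poly k) z = 0"
proof -
  assume "z \<in> cheb_nodes k"
  then obtain i where i: "i < k" "z = cos (real (2 * i + 1) * pi / (2 * real k))"
    by (auto simp: cheb_nodes_def)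
  have "real k * (real (2 * i + 1) * pi / (2 * real k)) = real (2 * i + 1) * (pi / 2)"
    using i by (simp add: field_simps)
  then have "poly (cheb_poly k) z = cos (real (2 * i + 1) * (pi / 2))"
    unfolding i(2) cheb_poly_cos by (simp only:)
  also have "\<dots> = 0" unfolding cos_zero_iff by (intro disjI1 exI[of _ "2 * i + 1"]) auto
  finally show ?thesis .
qed

lemma card_cheb_nodes: "card (cheb_nodes k) = k"
proof -
  have "inj_on (\<lambda>i. cos (real (2 * i + 1) * pi / (2 * real k))) {..<k}"
  proof (rule inj_onI)
    fix i j assume ij: "i \<in> {..<k}" "j \<in> {..<k}"
      "cos (real (2 * i + 1) * pi / (2 * real k)) = cos (real (2 * j + 1) * pi / (2 * real k))"
    have bd: "0 \<le> real (2 * l + 1) * pi / (2 * real k) \<and> real (2 * l + 1) * pi / (2 * real k) \<le> pi"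
      if "l < k" for l
    proof -
      have "real (2 * l + 1) * pi \<le> (2 * real k) * pi" using that by (intro mult_right_mono) auto
      then show ?thesis using that by (simp add: field_simps)
    qed
    have "real (2 * i + 1) * pi / (2 * real k) = real (2 * j + 1) * pi / (2 * real k)"
      by (rule cos_inj_pi) (use bd[of i] bd[of j] ij in blast)+
    then have "real (2 * i + 1) = real (2 * j + 1)" using ij pi_gt_zero by (auto simp: field_simps)
    then show "i = j" by simp
  qed
  then show ?thesis by (simp add: cheb_nodes_def card_image)
qed

text \<open>Take T_k for \<open>W\<close>: it is bounded by 1 and has leading coefficient
  \<open>2 ^ (k - 1)\<close>. Writing the constant as \<open>2 / 2 ^ k\<close> keeps one formula for
  all \<open>k\<close>; for \<open>k = 0\<close> it loses a factor 2.\<close>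

lemma vanishing_cheb_nodes_bound:
  assumes F: "deriv_chain k F" and Z: "\<And>z. z \<in> cheb_nodes k \<Longrightarrow> F 0 z = 0"
    and C: "\<And>y. \<lbrakk>-1 \<le> y; y \<le> 1\<rbrakk> \<Longrightarrow> \<bar>F k y\<bar> \<le> C"
    and x: "-1 \<le> x" "x \<le> 1"
  shows "\<bar>F 0 x\<bar> \<le> 2 * C / (fact k * 2 ^ k)"
proof -
  have "0 \<le> C" using C[OF x] by simp
  have "\<bar>F 0 x\<bar> \<le> \<bar>poly (cheb_poly k) x\<bar> * C / (fact k * coeff (cheb_poly k) k)"
    by (rule vanishing_bound[OF F _ _ cheb_nodes card_cheb_nodes Z cheb_nodes_root C x])
      (auto simp: cheb_poly_degree cheb_poly_coeff)
  also have "\<dots> \<le> 1 * C / (fact k * 2 ^ (k - 1))"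
    unfolding cheb_poly_coeff using abs_cheb_poly_le_1[OF x] \<open>0 \<le> C\<close>
    by (intro divide_right_mono mult_right_mono) auto
  also have "\<dots> \<le> 2 * C / (fact k * 2 ^ k)"
  proof -
    have "(2::real) ^ k \<le> 2 * 2 ^ (k - 1)" by (cases k) auto
    then have "2 * C / (fact k * (2 * 2 ^ (k - 1))) \<le> 2 * C / (fact k * 2 ^ k)"
      using \<open>0 \<le> C\<close> by (intro divide_left_mono mult_left_mono) auto
    then show ?thesis by simp
  qed
  finally show ?thesis .
qed

text \<open>Extremality of T_n: otherwise the difference \<open>D\<close> of T_n and the rescaled
  \<open>W\<close> takes alternating signs at the \<open>n + 1\<close> extrema of T_n and so has
  \<open>n\<close> zeros. As the leading coefficients agree, both polynomials coincide, which fails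
  at 1.\<close>

lemma monic_sup_lower_bound:
  fixes W :: "real poly"
  assumes W: "degree W \<le> n" "coeff W n = 1" and n: "n > 0"
    and B: "\<And>x. \<lbrakk>-1 \<le> x; x \<le> 1\<rbrakk> \<Longrightarrow> \<bar>poly W x\<bar> \<le> B"
  shows "1 \<le> 2 ^ (n - 1) * B"
proof (rule ccontr)
  assume "\<not> 1 \<le> 2 ^ (n - 1) * B"
  then have small: "\<bar>2 ^ (n - 1) * poly W x\<bar> < 1" if "-1 \<le> x" "x \<le> 1" for x
  proof -
    have "\<bar>2 ^ (n - 1) * poly W x\<bar> \<le> 2 ^ (n - 1) * B"
      unfolding abs_mult using B[OF that] by (intro mult_mono) auto
    then show ?thesis using \<open>\<not> 1 \<le> 2 ^ (n - 1) * B\<close> by linarith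
  qed
  define t where "t k = cos (real k * pi / real n)" for k
  define D where "D = cheb_poly n - smult (2 ^ (n - 1)) W"
  have sign: "(-1) ^ k * poly D (t k) > 0" for k
  proof -
    have "poly (cheb_poly n) (t k) = (-1) ^ k"
      using n by (simp add: t_def cheb_poly_cos)
    then have "(-1) ^ k * poly D (t k) = 1 - (-1) ^ k * (2 ^ (n - 1) * poly W (t k))"
      by (simp add: D_def algebra_simps flip: power_mult_distrib)
    moreover have "\<bar>(-1) ^ k * (2 ^ (n - 1) * poly W (t k))\<bar> < 1"
      using small[of "t k"] by (simp add: abs_mult t_def)
    ultimately show ?thesis by linarith
  qed
  have lt: "t l < t k" if "k < l" "l \<le> n" for k l
  proof -
    have "real k * pi / real n < real l * pi / real n" "real l * pi / real n \<le> pi"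
      using that by (auto simp: field_simps)
    then show ?thesis unfolding t_def by (intro cos_monotone_0_pi) auto
  qed
  have "\<exists>z. t (Suc k) < z \<and> z < t k \<and> poly D z = 0" if "k < n" for k
  proof -
    have "0 < ((-1) ^ k * poly D (t k)) * ((-1) ^ Suc k * poly D (t (Suc k)))"
      by (intro mult_pos_pos sign)
    then have "poly D (t (Suc k)) * poly D (t k) < 0"
      by (simp add: algebra_simps flip: power_mult_distrib)
    then show ?thesis using lt[of k "Suc k"] that poly_IVT[of "t (Suc k)" "t k" D] by auto
  qed
  then obtain z where z: "\<And>k. k < n \<Longrightarrow> t (Suc k) < z k \<and> z k < t k \<and> poly D (z k) = 0" by metis
  have zlt: "z l < z k" if "k < l" "l < n" for k l
  proof -
    have "t l \<le> t (Suc k)" using lt[of "Suc k" l] that by (cases "l = Suc k") auto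
    then show ?thesis using z[of k] z[of l] that by auto
  qed
  have "inj_on z {..<n}"
    by (rule inj_onI) (metis zlt lessThan_iff less_irrefl nat_neq_iff)
  then have card: "card (z ` {..<n}) = n" by (simp add: card_image)
  have "cheb_poly n = smult (2 ^ (n - 1)) W"
  proof (rule poly_eqI_degree_lead_coeff[where A = "z ` {..<n}" and n = n])
    show "poly (cheb_poly n) y = poly (smult (2 ^ (n - 1)) W) y" if "y \<in> z ` {..<n}" for y
      using z that by (auto simp: D_def)
  qed (use W card in \<open>auto simp: cheb_poly_degree cheb_poly_coeff\<close>)
  then have "poly (cheb_poly n) 1 = 2 ^ (n - 1) * poly W 1" by simp
  then show False using small[of 1] cheb_poly_cos[of n 0] by simp
qed

section \<open>Chebyshev polynomials as a basis\<close>

lemma cheb_poly_span: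
  "degree p \<le> n \<Longrightarrow> \<exists>a. p = (\<Sum>j\<le>n. smult (a j) (cheb_poly j))"
proof (induction n arbitrary: p)
  case 0
  then show ?case by (auto intro!: exI[of _ "\<lambda>_. coeff p 0"] elim: degree_eq_zeroE)
next
  case (Suc n)
  define c where "c = coeff p (Suc n) / 2 ^ n"
  have "degree (p - smult c (cheb_poly (Suc n))) \<le> n"
  proof (rule degree_le, intro allI impI)
    fix i assume "n < i"
    then consider "i = Suc n" | "i > Suc n" by linarith
    then show "coeff (p - smult c (cheb_poly (Suc n))) i = 0"
    proof cases
      case 1
      then show ?thesis using cheb_poly_coeff[of "Suc n"] by (simp add: c_def)
    next
      case 2
      then show ?thesis using Suc.prems cheb_poly_degree[of "Suc n"] by (simp add: coeff_eq_0)
    qed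
  qed
  then obtain a where a: "p - smult c (cheb_poly (Suc n)) = (\<Sum>j\<le>n. smult (a j) (cheb_poly j))"
    using Suc.IH by blast
  have "p = (\<Sum>j\<le>n. smult (a j) (cheb_poly j)) + smult c (cheb_poly (Suc n))"
    by (simp only: a[symmetric] diff_add_cancel)
  also have "\<dots> = (\<Sum>j\<le>Suc n. smult ((a(Suc n := c)) j) (cheb_poly j))" by simp
  finally show ?case by blast
qed

lemma cheb_poly_independent:
  "\<lbrakk>(\<Sum>j\<le>n. smult (a j) (cheb_poly j)) = 0; i \<le> n\<rbrakk> \<Longrightarrow> a i = 0"
proof (induction n)
  case (Suc n)
  have "coeff (\<Sum>j\<le>n. smult (a j) (cheb_poly j)) (Suc n) = 0"
    unfolding coeff_sum
  proof (intro sum.neutral ballI)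
    fix j assume "j \<in> {..n}"
    then show "coeff (Polynomial.smult (a j) (cheb_poly j)) (Suc n) = 0"
      using cheb_poly_degree[of j] by (simp add: coeff_eq_0)
  qed
  then have "coeff (\<Sum>j\<le>Suc n. smult (a j) (cheb_poly j)) (Suc n) = a (Suc n) * 2 ^ n"
    using cheb_poly_coeff[of "Suc n"] by simp
  then have "a (Suc n) = 0" unfolding Suc.prems(1) by simp
  then show ?case using Suc by (cases "i = Suc n") auto
qed simp

subsection \<open>The KKT system\<close>

lemma four_block_mat_mult_append:
  fixes A :: "'a :: comm_semiring_0 mat"
  assumes "A \<in> carrier_mat nr1 nc1" "B \<in> carrier_mat nr1 nc2"
    "C \<in> carrier_mat nr2 nc1" "D \<in> carrier_mat nr2 nc2"
    "u \<in> carrier_vec nc1" "v \<in> carrier_vec nc2"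
  shows "four_block_mat A B C D *\<^sub>v (u @\<^sub>v v) = (A *\<^sub>v u + B *\<^sub>v v) @\<^sub>v (C *\<^sub>v u + D *\<^sub>v v)"
proof (rule eq_vecI)
  fix i assume "i < dim_vec ((A *\<^sub>v u + B *\<^sub>v v) @\<^sub>v (C *\<^sub>v u + D *\<^sub>v v))"
  then have i: "i < nr1 + nr2" using assms by simp
  show "(four_block_mat A B C D *\<^sub>v (u @\<^sub>v v)) $ i =
      ((A *\<^sub>v u + B *\<^sub>v v) @\<^sub>v (C *\<^sub>v u + D *\<^sub>v v)) $ i"
  proof (cases "i < nr1")
    case True
    then show ?thesis using assms i
      by (simp add: row_four_block_mat[OF assms(1-4)] scalar_prod_append[of _ nc1 _ nc2])
  next
    case False
    then have "i - nr1 < nr2" using i by simp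
    with False show ?thesis using assms i
      by (simp add: row_four_block_mat[OF assms(1-4)] scalar_prod_append[of _ nc1 _ nc2])
  qed
qed (use assms in auto)

lemma cheb_mat_carrier: "cheb_mat k r x \<in> carrier_mat (k + 1) (r + 1)"
  by (simp add: cheb_mat_def)

lemma cheb_mat_mult_vec:
  assumes "\<And>i. i \<le> k \<Longrightarrow> x i \<in> {-1..1}"
  shows "cheb_mat k r x *\<^sub>v Matrix.vec (r + 1) a =
     Matrix.vec (k + 1) (\<lambda>i. poly (\<Sum>j\<le>r. smult (a j) (cheb_poly j)) (x i))"
  using assms
  by (intro eq_vecI)
    (auto simp: cheb_mat_def scalar_prod_def poly_sum chebyshev_T_poly mult.commute
      atLeast0LessThan lessThan_Suc_atMost intro!: sum.cong)

lemma transpose_cheb_mat_mult_vec: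
  assumes "\<And>i. i \<le> k \<Longrightarrow> x i \<in> {-1..1}"
  shows "transpose_mat (cheb_mat k r x) *\<^sub>v Matrix.vec (k + 1) z =
     Matrix.vec (r + 1) (\<lambda>j. \<Sum>i\<le>k. poly (cheb_poly j) (x i) * z i)"
  using assms
  by (intro eq_vecI)
    (auto simp: cheb_mat_def scalar_prod_def chebyshev_T_poly
      atLeast0LessThan lessThan_Suc_atMost intro!: sum.cong)

lemma kkt_mat_carrier: "kkt_mat n m r x \<in> carrier_mat ((r + 1) + (m + 1)) ((r + 1) + (m + 1))"
  unfolding kkt_mat_def Let_def
  by (intro four_block_carrier_mat) (auto simp: cheb_mat_def)



lemma kkt_mat_mult_append:
  assumes "a \<in> carrier_vec (r + 1)" "z \<in> carrier_vec (m + 1)"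
  shows "kkt_mat n m r x *\<^sub>v (a @\<^sub>v z) =
     (2 \<cdot>\<^sub>v (transpose_mat (cheb_mat n r x) *\<^sub>v (cheb_mat n r x *\<^sub>v a)) +
      transpose_mat (cheb_mat m r x) *\<^sub>v z) @\<^sub>v (cheb_mat m r x *\<^sub>v a)"
proof -
  let ?V = "cheb_mat n r x" and ?C = "cheb_mat m r x"
  have VV: "transpose_mat ?V * ?V \<in> carrier_mat (r + 1) (r + 1)"
    using cheb_mat_carrier[of n r x] by auto
  have "(2 \<cdot>\<^sub>m (transpose_mat ?V * ?V)) *\<^sub>v a = 2 \<cdot>\<^sub>v (transpose_mat ?V *\<^sub>v (?V *\<^sub>v a))"
    using assms(1) cheb_mat_carrier[of n r x] VV
    by (intro eq_vecI)
      (auto simp del: assoc_mult_mat_vec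
        simp: assoc_mult_mat_vec[of _ "r + 1" "n + 1" _ "r + 1", symmetric])
  moreover have "?C *\<^sub>v a + 0\<^sub>m (m + 1) (m + 1) *\<^sub>v z = ?C *\<^sub>v a"
    using assms cheb_mat_carrier[of m r x] by auto
  ultimately show ?thesis
    unfolding kkt_mat_def Let_def using assms VV cheb_mat_carrier[of m r x]
    by (subst four_block_mat_mult_append[of _ "r + 1" "r + 1" _ "m + 1" _ "m + 1"]) auto
qed

lemma real_scalar_prod_self_eq_0:
  fixes v :: "real vec"
  assumes "scalar_prod v v = 0" "i < dim_vec v"
  shows "v $ i = 0"
proof -
  have "(\<Sum>i\<in>{0..<dim_vec v}. v $ i * v $ i) = 0"
    using assms(1) by (simp add: scalar_prod_def)
  then have "\<forall>i\<in>{0..<dim_vec v}. v $ i * v $ i = 0"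
    by (subst (asm) sum_nonneg_eq_0_iff) auto
  then show ?thesis using assms(2) by auto
qed

lemma vec_eq_fun: "v \<in> carrier_vec k \<Longrightarrow> v = Matrix.vec k (\<lambda>i. v $ i)"
  by (intro eq_vecI) auto

text \<open>
  Pairing the first block row with \<open>a\<close> gives \<open>2 \<parallel>V a\<parallel>\<^sup>2 = 0\<close>, so the polynomial with
  coefficients \<open>a\<close> has \<open>n + 1 > r\<close> zeros; pairing \<open>C\<^sup>T z = 0\<close> with the coefficients of the
  Lagrange basis polynomials of the first \<open>m + 1\<close> nodes then gives \<open>z = 0\<close>.
\<close>

lemma kkt_mat_kernel:
  assumes x: "inj_on x {..n}" "\<And>i. i \<le> n \<Longrightarrow> x i \<in> {-1..1}" and le: "m \<le> r" "r \<le> n"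
    and s: "s \<in> carrier_vec ((r + 1) + (m + 1))"
    and ker: "kkt_mat n m r x *\<^sub>v s = 0\<^sub>v ((r + 1) + (m + 1))"
  shows "s = 0\<^sub>v ((r + 1) + (m + 1))"
proof -
  let ?V = "cheb_mat n r x" and ?C = "cheb_mat m r x"
  define a where "a = vec_first s (r + 1)"
  define z where "z = vec_last s (m + 1)"
  have a: "a \<in> carrier_vec (r + 1)" and z: "z \<in> carrier_vec (m + 1)" and sz: "s = a @\<^sub>v z"
    using s by (auto simp: a_def z_def)
  have xm: "x i \<in> {-1..1}" if "i \<le> m" for i using x(2)[of i] that le by simp
  have V: "?V \<in> carrier_mat (n + 1) (r + 1)" and C: "?C \<in> carrier_mat (m + 1) (r + 1)"
    by (rule cheb_mat_carrier)+
  have Va: "?V *\<^sub>v a \<in> carrier_vec (n + 1)" and Ca: "?C *\<^sub>v a \<in> carrier_vec (m + 1)"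
    and VVa: "transpose_mat ?V *\<^sub>v (?V *\<^sub>v a) \<in> carrier_vec (r + 1)"
    and Cz: "transpose_mat ?C *\<^sub>v z \<in> carrier_vec (r + 1)"
    using V C a z by auto
  have "(2 \<cdot>\<^sub>v (transpose_mat ?V *\<^sub>v (?V *\<^sub>v a)) + transpose_mat ?C *\<^sub>v z) @\<^sub>v (?C *\<^sub>v a) =
      0\<^sub>v (r + 1) @\<^sub>v 0\<^sub>v (m + 1)"
    using ker unfolding sz kkt_mat_mult_append[OF a z] by (intro eq_vecI) (auto simp: cheb_mat_def)
  then have row1: "2 \<cdot>\<^sub>v (transpose_mat ?V *\<^sub>v (?V *\<^sub>v a)) + transpose_mat ?C *\<^sub>v z = 0\<^sub>v (r + 1)"
    and row2: "?C *\<^sub>v a = 0\<^sub>v (m + 1)"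
    using VVa Cz by (auto simp: append_vec_eq[of _ "r + 1"])
  have "0 = scalar_prod (2 \<cdot>\<^sub>v (transpose_mat ?V *\<^sub>v (?V *\<^sub>v a)) + transpose_mat ?C *\<^sub>v z) a"
    unfolding row1 using a by simp
  also have "\<dots> = 2 * scalar_prod (transpose_mat ?V *\<^sub>v (?V *\<^sub>v a)) a +
      scalar_prod (transpose_mat ?C *\<^sub>v z) a"
    using VVa Cz a by (subst add_scalar_prod_distrib[of _ "r + 1"]) auto
  also have "\<dots> = 2 * scalar_prod (?V *\<^sub>v a) (?V *\<^sub>v a) + scalar_prod z (?C *\<^sub>v a)"
    using transpose_vec_mult_scalar[OF V a Va] transpose_vec_mult_scalar[OF C a z] by simp
  also have "scalar_prod z (?C *\<^sub>v a) = 0" unfolding row2 using z by simp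
  finally have "scalar_prod (?V *\<^sub>v a) (?V *\<^sub>v a) = 0" by simp
  then have Va0: "(?V *\<^sub>v a) $ i = 0" if "i \<le> n" for i
    by (rule real_scalar_prod_self_eq_0) (use V that in auto)
  define P where "P = (\<Sum>j\<le>r. smult (a $ j) (cheb_poly j))"
  have degP: "degree P \<le> r"
    unfolding P_def
    by (intro degree_sum_le order_trans[OF degree_smult_le] order_trans[OF cheb_poly_degree]) auto
  have "poly P (x i) = 0" if "i \<le> n" for i
    using Va0[OF that] that cheb_mat_mult_vec[of n x r "\<lambda>i. a $ i", OF x(2)]
    unfolding P_def vec_eq_fun[OF a, symmetric] by simp
  then have "P = 0"
    using degP le card_image[OF x(1)] by (intro poly_eqI_degree[where A = "x ` {..n}"]) auto
  then have "a $ i = 0" if "i \<le> r" for i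
    using cheb_poly_independent[of "\<lambda>i. a $ i" r i] that by (simp add: P_def)
  then have a0: "a = 0\<^sub>v (r + 1)" using a by (intro eq_vecI) auto
  have "transpose_mat ?C *\<^sub>v z = 0\<^sub>v (r + 1)"
  proof -
    have "?V *\<^sub>v 0\<^sub>v (r + 1) = 0\<^sub>v (n + 1)" "transpose_mat ?V *\<^sub>v 0\<^sub>v (n + 1) = 0\<^sub>v (r + 1)"
      "2 \<cdot>\<^sub>v 0\<^sub>v (r + 1) = (0\<^sub>v (r + 1) :: real vec)"
      using V by (auto intro!: eq_vecI)
    then show ?thesis using row1 Cz unfolding a0 by (simp only: left_zero_vec)
  qed
  then have "Matrix.vec (r + 1) (\<lambda>j. \<Sum>i\<le>m. poly (cheb_poly j) (x i) * z $ i) = 0\<^sub>v (r + 1)"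
    using transpose_cheb_mat_mult_vec[of m x r "\<lambda>i. z $ i", OF xm]
    unfolding vec_eq_fun[OF z, symmetric] by simp
  then have "Matrix.vec (r + 1) (\<lambda>j. \<Sum>i\<le>m. poly (cheb_poly j) (x i) * z $ i) $ j = 0\<^sub>v (r + 1) $ j" for j
    by (simp only:)
  note Cz = this
  have Cz0: "(\<Sum>i\<le>m. poly (cheb_poly j) (x i) * z $ i) = 0" if "j \<le> r" for j
    using Cz[of j] that by simp
  have "z $ k = 0" if k: "k \<le> m" for k
  proof -
    have inj: "inj_on x {..m}" using x(1) by (rule inj_on_subset) (use le in auto)
    obtain p where p: "degree p \<le> m" "\<forall>y\<in>x ` {..m}. poly p y = (if y = x k then 1 else 0)"
      using poly_interpolation[of "x ` {..m}" "\<lambda>y. if y = x k then 1 else 0"]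
        card_image[OF inj] by auto
    obtain b where b: "p = (\<Sum>j\<le>r. smult (b j) (cheb_poly j))"
      using cheb_poly_span[of p r] p(1) le by auto
    \<comment> \<open>The relations \<open>Cz0\<close> say that \<open>z\<close> is orthogonal to
      the node values of each T_j with \<open>j \<le> r\<close>, hence to those of every polynomial
      of degree at most \<open>r\<close>.\<close>
    have "(\<Sum>i\<le>m. poly p (x i) * z $ i) =
        (\<Sum>j\<le>r. b j * (\<Sum>i\<le>m. poly (cheb_poly j) (x i) * z $ i))"
      unfolding b by (simp add: poly_sum sum_distrib_right sum_distrib_left mult.assoc)
        (rule sum.swap)
    also have "\<dots> = 0" by (simp add: Cz0)
    finally have "0 = (\<Sum>i\<le>m. poly p (x i) * z $ i)" by simp
    also have "\<dots> = (\<Sum>i\<le>m. if i = k then z $ i else 0)"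
      using p(2) k inj_onD[OF inj] by (intro sum.cong) auto
    also have "\<dots> = z $ k" using k by simp
    finally show ?thesis by simp
  qed
  then have "z = 0\<^sub>v (m + 1)" using z by (intro eq_vecI) auto
  then show ?thesis unfolding sz a0 by (intro eq_vecI) auto
qed

text \<open>A trivial kernel gives a nonzero determinant, so \<open>mat_inverse\<close> returns a
  matrix and the \<open>the\<close> in \<open>mat_inv\<close> is meaningful.\<close>

lemma mat_inv_kkt_mat:
  assumes x: "inj_on x {..n}" "\<And>i. i \<le> n \<Longrightarrow> x i \<in> {-1..1}" and le: "m \<le> r" "r \<le> n"
  defines "M \<equiv> kkt_mat n m r x" and "N \<equiv> (r + 1) + (m + 1)"
  shows "mat_inv M \<in> carrier_mat N N" "M * mat_inv M = 1\<^sub>m N" "mat_inv M * M = 1\<^sub>m N"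
proof -
  have M: "M \<in> carrier_mat N N" unfolding M_def N_def by (rule kkt_mat_carrier)
  have "Determinant.det M \<noteq> 0"
    unfolding det_0_iff_vec_prod_zero_field[OF M]
    using kkt_mat_kernel[OF x le] by (auto simp: M_def N_def)
  then have "mat_inverse M \<noteq> None"
    using mat_inverse(1)[OF M, of "()"] det_non_zero_imp_unit[OF M, of "()"] by blast
  then obtain B where B: "mat_inverse M = Some B" by blast
  then have "mat_inv M = B" by (simp add: mat_inv_def)
  then show "mat_inv M \<in> carrier_mat N N" "M * mat_inv M = 1\<^sub>m N" "mat_inv M * M = 1\<^sub>m N"
    using mat_inverse(2)[OF M B] by auto
qed

lemma kkt_sol_eq:
  assumes x: "inj_on x {..n}" "\<And>i. i \<le> n \<Longrightarrow> x i \<in> {-1..1}" and le: "m \<le> r" "r \<le> n"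
    and s: "s \<in> carrier_vec ((r + 1) + (m + 1))" "kkt_mat n m r x *\<^sub>v s = kkt_rhs n m r x f"
  shows "kkt_sol n m r x f = s"
  unfolding kkt_sol_def
proof (rule the_equality)
  fix s' assume s': "s' \<in> carrier_vec ((r + 1) + (m + 1)) \<and> kkt_mat n m r x *\<^sub>v s' = kkt_rhs n m r x f"
  have "s' = (mat_inv (kkt_mat n m r x) * kkt_mat n m r x) *\<^sub>v s'"
    using s' by (simp only: mat_inv_kkt_mat[OF x le]) simp
  also have "\<dots> = mat_inv (kkt_mat n m r x) *\<^sub>v (kkt_mat n m r x *\<^sub>v s')"
    using s' by (intro assoc_mult_mat_vec[OF mat_inv_kkt_mat(1)[OF x le] kkt_mat_carrier]) auto
  also have "\<dots> = mat_inv (kkt_mat n m r x) *\<^sub>v (kkt_mat n m r x *\<^sub>v s)" using s' s by simp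
  also have "\<dots> = (mat_inv (kkt_mat n m r x) * kkt_mat n m r x) *\<^sub>v s"
    using s by (intro assoc_mult_mat_vec[OF mat_inv_kkt_mat(1)[OF x le] kkt_mat_carrier, symmetric])
  also have "\<dots> = s" using s by (simp only: mat_inv_kkt_mat[OF x le]) simp
  finally show "s' = s" .
qed (use s in auto)

section \<open>One-norm estimates for the KKT system\<close>

lemma col_sum_le_mat_norm1:
  assumes "j < dim_col A"
  shows "(\<Sum>i<dim_row A. \<bar>A $$ (i, j)\<bar>) \<le> mat_norm1 A"
proof -
  have pos: "dim_col A > 0" using assms by simp
  show ?thesis unfolding mat_norm1_eq_max_col_sum[OF pos] using assms by (intro Max_ge) auto
qed

lemma mat_norm1_nonneg: "dim_col A > 0 \<Longrightarrow> 0 \<le> mat_norm1 A"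
  by (rule order_trans[OF sum_nonneg col_sum_le_mat_norm1]) auto

lemma vec_norm1_mult_mat_vec_le:
  assumes "v \<in> carrier_vec (dim_col A)"
  shows "vec_norm1 (A *\<^sub>v v) \<le> mat_norm1 A * vec_norm1 v"
proof -
  have "vec_norm1 (A *\<^sub>v v) = (\<Sum>i<dim_row A. \<bar>\<Sum>j<dim_col A. A $$ (i, j) * v $ j\<bar>)"
    unfolding vec_norm1_def using assms
    by (auto simp: scalar_prod_def atLeast0LessThan intro!: sum.cong arg_cong[where f = abs])
  also have "\<dots> \<le> (\<Sum>i<dim_row A. \<Sum>j<dim_col A. \<bar>A $$ (i, j)\<bar> * \<bar>v $ j\<bar>)"
    by (intro sum_mono order_trans[OF sum_abs]) (simp add: abs_mult)
  also have "\<dots> = (\<Sum>j<dim_col A. (\<Sum>i<dim_row A. \<bar>A $$ (i, j)\<bar>) * \<bar>v $ j\<bar>)"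
    by (subst sum.swap) (simp add: sum_distrib_right)
  also have "\<dots> \<le> (\<Sum>j<dim_col A. mat_norm1 A * \<bar>v $ j\<bar>)"
    by (intro sum_mono mult_right_mono col_sum_le_mat_norm1) auto
  also have "\<dots> = mat_norm1 A * vec_norm1 v"
    using assms by (simp add: vec_norm1_def sum_distrib_left)
  finally show ?thesis .
qed

text \<open>Since T_0 = 1, the top left entry is \<open>2 * (n + 1)\<close>, and a column sum
  dominates each of its entries. This lets the number of nodes be absorbed into the condition
  number.\<close>

lemma mat_norm1_kkt_mat_ge: "2 * real (n + 1) \<le> mat_norm1 (kkt_mat n m r x)"
proof -
  let ?V = "cheb_mat n r x" and ?M = "kkt_mat n m r x"
  have M: "?M \<in> carrier_mat ((r + 1) + (m + 1)) ((r + 1) + (m + 1))" by (rule kkt_mat_carrier)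
  have "?M $$ (0, 0) = 2 * (transpose_mat ?V * ?V) $$ (0, 0)"
    unfolding kkt_mat_def Let_def by (simp add: cheb_mat_def)
  also have "(transpose_mat ?V * ?V) $$ (0, 0) = (\<Sum>i = 0..<n + 1. 1)"
    unfolding times_mat_def scalar_prod_def
    by (auto simp: cheb_mat_def chebyshev_T_def intro!: sum.cong)
  finally have "2 * real (n + 1) = \<bar>?M $$ (0, 0)\<bar>" by simp
  also have "\<dots> \<le> (\<Sum>i<dim_row ?M. \<bar>?M $$ (i, 0)\<bar>)"
    using M by (intro member_le_sum[of 0 _ "\<lambda>i. \<bar>?M $$ (i, 0)\<bar>"]) auto
  also have "\<dots> \<le> mat_norm1 ?M"
    using M by (intro col_sum_le_mat_norm1) auto
  finally show ?thesis .
qed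

lemma cheb_sum_bound:
  assumes "\<And>i. i \<le> n \<Longrightarrow> x i \<in> {-1..1}" "\<And>i. i \<le> n \<Longrightarrow> \<bar>e i\<bar> \<le> E"
  shows "\<bar>\<Sum>i\<le>n. poly (cheb_poly j) (x i) * e i\<bar> \<le> real (n + 1) * E"
proof -
  have "\<bar>poly (cheb_poly j) (x i) * e i\<bar> \<le> 1 * E" if "i \<le> n" for i
    unfolding abs_mult using assms that abs_cheb_poly_le_1 by (intro mult_mono) auto
  then have "(\<Sum>i\<le>n. \<bar>poly (cheb_poly j) (x i) * e i\<bar>) \<le> (\<Sum>i\<le>n. E)"
    by (intro sum_mono) auto
  then show ?thesis by (intro order_trans[OF sum_abs]) simp
qed

lemma sum_lessThan_add:
  fixes f :: "nat \<Rightarrow> 'a :: comm_monoid_add"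
  shows "(\<Sum>i<a + b. f i) = (\<Sum>i<a. f i) + (\<Sum>i<b. f (a + i))"
  by (induction b) (auto simp: add.assoc)

text \<open>The operator reproduces \<open>q\<close>, so by linearity the deviation \<open>w\<close>
  solves the same system with right-hand side \<open>g\<close> built from \<open>f - q\<close>. The
  1-norm of \<open>g\<close> times the norm of the inverse gives the constant of
  \<open>B_const\<close>.\<close>

lemma cmcls_near_polynomial:
  assumes x: "inj_on x {..n}" "\<And>i. i \<le> n \<Longrightarrow> x i \<in> {-1..1}" and le: "m \<le> r" "r \<le> n"
    and q: "degree q \<le> r" and E: "\<And>y. \<lbrakk>-1 \<le> y; y \<le> 1\<rbrakk> \<Longrightarrow> \<bar>f y - poly q y\<bar> \<le> E"
  shows "\<exists>w. (\<forall>t\<in>{-1..1}. cmcls n m r x f t = poly (q + (\<Sum>i\<le>r. smult (w i) (cheb_poly i))) t) \<and>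
     (\<Sum>i\<le>r. \<bar>w i\<bar>) \<le> B_const m r (kkt_mat n m r x) * E"
proof -
  let ?N = "(r + 1) + (m + 1)"
  define M where "M = kkt_mat n m r x"
  define e where "e y = f y - poly q y" for y
  have M: "M \<in> carrier_mat ?N ?N" unfolding M_def by (rule kkt_mat_carrier)
  note inv = mat_inv_kkt_mat[OF x le, folded M_def]
  have xm: "x i \<in> {-1..1}" if "i \<le> m" for i using x(2)[of i] that le by simp
  have E0: "0 \<le> E" using E[of 0] by simp
  obtain b where b: "q = (\<Sum>j\<le>r. smult (b j) (cheb_poly j))" using cheb_poly_span[OF q] by blast
  \<comment> \<open>Coefficients of \<open>q\<close> with zero multipliers: the exact solution of
    the system belonging to \<open>q\<close>.\<close>
  define s0 where "s0 = Matrix.vec (r + 1) b @\<^sub>v 0\<^sub>v (m + 1)"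
  define g where "g = Matrix.vec (r + 1) (\<lambda>j. 2 * (\<Sum>i\<le>n. poly (cheb_poly j) (x i) * e (x i))) @\<^sub>v
    Matrix.vec (m + 1) (\<lambda>i. e (x i))"
  have s0: "s0 \<in> carrier_vec ?N" and g: "g \<in> carrier_vec ?N"
    unfolding s0_def g_def by (intro append_carrier_vec; simp)+
  define w where "w = mat_inv M *\<^sub>v g"
  have w: "w \<in> carrier_vec ?N" using inv g by (auto simp: w_def)
  have T: "transpose_mat (cheb_mat n r x) *\<^sub>v Matrix.vec (n + 1) h =
     Matrix.vec (r + 1) (\<lambda>j. \<Sum>i\<le>n. poly (cheb_poly j) (x i) * h i)" for h
    by (rule transpose_cheb_mat_mult_vec) (use x(2) in blast)
  have Ms0: "M *\<^sub>v s0 = Matrix.vec (r + 1) (\<lambda>j. 2 * (\<Sum>i\<le>n. poly (cheb_poly j) (x i) * poly q (x i))) @\<^sub>v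
      Matrix.vec (m + 1) (\<lambda>i. poly q (x i))"
  proof -
    have C0: "transpose_mat (cheb_mat m r x) *\<^sub>v 0\<^sub>v (m + 1) = 0\<^sub>v (r + 1)"
      using cheb_mat_carrier[of m r x] by auto
    have Cb: "cheb_mat k r x *\<^sub>v Matrix.vec (r + 1) b = Matrix.vec (k + 1) (\<lambda>i. poly q (x i))"
      if "k \<le> n" for k
      using cheb_mat_mult_vec[of k x r b] x(2) that by (simp add: b)
    have "M *\<^sub>v s0 =
      (2 \<cdot>\<^sub>v (transpose_mat (cheb_mat n r x) *\<^sub>v (cheb_mat n r x *\<^sub>v Matrix.vec (r + 1) b)) +
      transpose_mat (cheb_mat m r x) *\<^sub>v 0\<^sub>v (m + 1)) @\<^sub>v (cheb_mat m r x *\<^sub>v Matrix.vec (r + 1) b)"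
      unfolding M_def s0_def by (rule kkt_mat_mult_append) auto
    then show ?thesis
      unfolding C0 Cb[OF order_refl] Cb[OF order_trans[OF le]] T
      by (auto intro!: eq_vecI)
  qed
  have rhs: "kkt_rhs n m r x f = M *\<^sub>v s0 + g"
    unfolding kkt_rhs_def Let_def T Ms0 g_def e_def
    by (intro eq_vecI) (auto simp: sum_subtractf right_diff_distrib)
  have "M *\<^sub>v (s0 + w) = M *\<^sub>v s0 + (M * mat_inv M) *\<^sub>v g"
    using M s0 w g inv(1) by (simp add: mult_add_distrib_mat_vec w_def)
  also have "(M * mat_inv M) *\<^sub>v g = g" using g by (simp only: inv) simp
  finally have sol: "kkt_sol n m r x f = s0 + w"
    using s0 w rhs by (intro kkt_sol_eq[OF x le]) (auto simp: M_def)
  have "cmcls n m r x f t = poly (q + (\<Sum>i\<le>r. smult (w $ i) (cheb_poly i))) t" if "t \<in> {-1..1}" for t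
  proof -
    have "cmcls n m r x f t = (\<Sum>i\<le>r. (b i + w $ i) * poly (cheb_poly i) t)"
      unfolding cmcls_def sol using that w
      by (intro sum.cong) (auto simp: s0_def chebyshev_T_poly)
    then show ?thesis by (simp add: b poly_sum distrib_right sum.distrib)
  qed
  moreover have "(\<Sum>i\<le>r. \<bar>w $ i\<bar>) \<le> B_const m r M * E"
  proof -
    \<comment> \<open>The first \<open>r + 1\<close> entries are at most
      \<open>2 * (n + 1) * E\<close> because Chebyshev polynomials are bounded by 1; the other
      \<open>m + 1\<close> are values of \<open>f - q\<close>.\<close>
    have ng: "vec_norm1 g \<le> (2 * real (r + 1) * real (n + 1) + real (m + 1)) * E"
    proof -
      have "vec_norm1 g = (\<Sum>i<(r + 1) + (m + 1). \<bar>g $ i\<bar>)"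
        using g by (simp add: vec_norm1_def)
      also have "\<dots> = (\<Sum>i<r + 1. \<bar>g $ i\<bar>) + (\<Sum>i<m + 1. \<bar>g $ (r + 1 + i)\<bar>)"
        by (rule sum_lessThan_add)
      also have "\<dots> \<le> (\<Sum>i<r + 1. 2 * (real (n + 1) * E)) + (\<Sum>i<m + 1. E)"
      proof (intro add_mono sum_mono)
        fix i assume "i \<in> {..<r + 1}"
        then have "\<bar>g $ i\<bar> = 2 * \<bar>\<Sum>k\<le>n. poly (cheb_poly i) (x k) * e (x k)\<bar>"
          by (simp add: g_def abs_mult)
        also have "\<dots> \<le> 2 * (real (n + 1) * E)"
          using x(2) E by (intro mult_left_mono cheb_sum_bound) (auto simp: e_def)
        finally show "\<bar>g $ i\<bar> \<le> 2 * (real (n + 1) * E)" .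
      next
        fix i assume "i \<in> {..<m + 1}"
        then show "\<bar>g $ (r + 1 + i)\<bar> \<le> E" using E xm by (simp add: g_def e_def)
      qed
      finally show ?thesis by (simp add: algebra_simps)
    qed
    have ge: "0 \<le> mat_norm1 (mat_inv M)" using inv(1) by (intro mat_norm1_nonneg) auto
    have "(\<Sum>i\<le>r. \<bar>w $ i\<bar>) \<le> vec_norm1 w"
      unfolding vec_norm1_def using w by (intro sum_mono2) auto
    also have "\<dots> \<le> mat_norm1 (mat_inv M) * vec_norm1 g"
      unfolding w_def using inv(1) g by (intro vec_norm1_mult_mat_vec_le) auto
    also have "\<dots> \<le> mat_norm1 (mat_inv M) * ((2 * real (r + 1) * real (n + 1) + real (m + 1)) * E)"
      by (intro mult_left_mono ng ge)
    \<comment> \<open>Here \<open>n + 1\<close> is replaced by the norm of \<open>M\<close>, which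
      turns the first summand into a multiple of the condition number.\<close>
    also have "\<dots> \<le> mat_norm1 (mat_inv M) * ((2 * real (r + 1) * mat_norm1 M + real (m + 1)) * E)"
      using mat_norm1_kkt_mat_ge[of n m r x] E0 ge
      by (intro mult_left_mono mult_right_mono add_right_mono) (auto simp: M_def)
    also have "\<dots> = B_const m r M * E" by (simp add: B_const_def cond1_def algebra_simps)
    finally show ?thesis .
  qed
  ultimately show ?thesis unfolding M_def by blast
qed

lemma B_const_nonneg:
  assumes x: "inj_on x {..n}" "\<And>i. i \<le> n \<Longrightarrow> x i \<in> {-1..1}" and le: "m \<le> r" "r \<le> n"
  shows "0 \<le> B_const m r (kkt_mat n m r x)"
proof -
  have "0 \<le> mat_norm1 (mat_inv (kkt_mat n m r x))"
    using mat_inv_kkt_mat(1)[OF x le] by (intro mat_norm1_nonneg) auto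
  moreover have "0 \<le> mat_norm1 (kkt_mat n m r x)"
    using kkt_mat_carrier[of n m r x] by (intro mat_norm1_nonneg) auto
  ultimately show ?thesis by (simp add: B_const_def cond1_def)
qed

subsection \<open>The error bound\<close>

text \<open>With R = d + k the product is R (R + k - 1)! / (R - k)!, stated cross-multiplied and
  without subtraction. The induction moves one unit from \<open>k\<close> to \<open>d\<close>, which
  keeps R fixed.\<close>

lemma prod_square_diff_closed_form:
  "fact d * real (d + 2 * k) * (\<Prod>j<k. (real (d + k))\<^sup>2 - (real j)\<^sup>2) = real (d + k) * fact (d + 2 * k)"
proof (induction k arbitrary: d)
  case (Suc k)
  let ?P = "\<Prod>j<k. (real (Suc d + k))\<^sup>2 - (real j)\<^sup>2"
  have P: "(\<Prod>j<Suc k. (real (d + Suc k))\<^sup>2 - (real j)\<^sup>2) = ?P * (real (d + 1) * real (Suc d + 2 * k))"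
    by (simp add: power2_eq_square algebra_simps)
  have "fact d * real (d + 2 * Suc k) * (\<Prod>j<Suc k. (real (d + Suc k))\<^sup>2 - (real j)\<^sup>2) =
      real (d + 2 * Suc k) * (fact (Suc d) * real (Suc d + 2 * k) * ?P)"
    unfolding P by simp
  also have "\<dots> = real (d + 2 * Suc k) * (real (Suc d + k) * fact (Suc d + 2 * k))"
    unfolding Suc ..
  also have "\<dots> = real (d + Suc k) * fact (d + 2 * Suc k)" by simp
  finally show ?case .
qed (simp)

text \<open>At fixed \<open>d\<close>, passing from \<open>k\<close> to \<open>k + 1\<close>
  multiplies the product by (d+k+1)(d+2k+1)(d+2k)/(d+k), which is at least (2k+2)(2k+1), the growth
  of \<open>fact (2 * k)\<close>. The base case is 4d <= (d+1)^2.\<close>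

lemma prod_square_diff_lower_bound:
  assumes "d \<ge> 1" "k \<ge> 1"
  shows "2 * real d * fact (2 * k) \<le> (\<Prod>j<k. (real (d + k))\<^sup>2 - (real j)\<^sup>2)"
  using assms(2)
proof (induction k rule: dec_induct)
  case base
  have "0 \<le> (real d - 1)\<^sup>2" by simp
  then show ?case by (simp add: power2_eq_square algebra_simps)
next
  case (step k)
  let ?P = "\<lambda>k. \<Prod>j<k. (real (d + k))\<^sup>2 - (real j)\<^sup>2"
  have P0: "0 \<le> ?P k" using step.IH by (rule order_trans[rotated]) simp
  have "fact d * real (d + 2 * Suc k) * ?P (Suc k) = real (d + Suc k) * fact (d + 2 * Suc k)"
    by (rule prod_square_diff_closed_form)
  also have "fact (d + 2 * Suc k) = real (d + 2 * Suc k) * (real (d + 2 * k + 1) * fact (d + 2 * k))"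
    by simp
  finally have *: "fact d * ?P (Suc k) = real (d + Suc k) * (real (d + 2 * k + 1) * fact (d + 2 * k))"
    by simp
  have "fact d * (real (d + k) * ?P (Suc k)) = real (d + k) * (fact d * ?P (Suc k))" by simp
  also have "\<dots> = real (d + Suc k) * real (d + 2 * k + 1) * (real (d + k) * fact (d + 2 * k))"
    unfolding * by (simp only: mult_ac)
  also have "\<dots> = fact d * (real (d + Suc k) * real (d + 2 * k + 1) * (real (d + 2 * k) * ?P k))"
    unfolding prod_square_diff_closed_form[symmetric] by (simp only: mult_ac)
  finally have rec: "real (d + k) * ?P (Suc k) =
      real (d + Suc k) * real (d + 2 * k + 1) * (real (d + 2 * k) * ?P k)"
    by (simp only: mult_cancel_left fact_nonzero simp_thms)
  have "real (d + k) * (real (2 * k + 2) * real (2 * k + 1) * ?P k) \<le>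
      real (d + Suc k) * (real (d + 2 * k + 1) * real (d + 2 * k) * ?P k)"
    using P0 assms(1) by (intro mult_mono) auto
  also have "\<dots> = real (d + k) * ?P (Suc k)" unfolding rec by (simp only: mult_ac)
  finally have "real (2 * k + 2) * real (2 * k + 1) * ?P k \<le> ?P (Suc k)"
    using assms(1) by (simp only: mult_le_cancel_left)
  moreover have "real (2 * k + 2) * real (2 * k + 1) * (2 * real d * fact (2 * k)) \<le>
      real (2 * k + 2) * real (2 * k + 1) * ?P k"
    using step.IH by (intro mult_left_mono) auto
  moreover have "2 * real d * fact (2 * Suc k) =
      real (2 * k + 2) * real (2 * k + 1) * (2 * real d * fact (2 * k))"
    by simp
  ultimately show ?case by linarith
qed

lemma prod_odd_fact: "(\<Prod>j<k. 2 * real j + 1) * (2 ^ k * fact k) = fact (2 * k)"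
proof (induction k)
  case (Suc k)
  have "(\<Prod>j<Suc k. 2 * real j + 1) * (2 ^ Suc k * fact (Suc k)) =
      ((\<Prod>j<k. 2 * real j + 1) * (2 ^ k * fact k)) * ((2 * real k + 1) * (2 * (real k + 1)))"
    by (simp add: mult_ac)
  also have "\<dots> = fact (2 * Suc k)" unfolding Suc by (simp add: algebra_simps)
  finally show ?case .
qed simp

text \<open>The right-hand side is the k-th derivative of T_{r+1} at 1. The left-hand side is what
  remains to be dominated in the first term after the lower bound for the node polynomial.\<close>

lemma cheb_deriv_factor_lower_bound:
  assumes "1 \<le> k" "k \<le> r"
  shows "2 * (2 ^ k * fact k) * real (r + 1 - k) \<le>
     (\<Prod>j<k. (real r + 1)\<^sup>2 - (real j)\<^sup>2) / (\<Prod>j<k. 2 * real j + 1)"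
proof -
  have pos: "0 < (\<Prod>j<k. 2 * real j + 1)" by (intro prod_pos) auto
  have "2 * real (r + 1 - k) * fact (2 * k) \<le> (\<Prod>j<k. (real (r + 1 - k + k))\<^sup>2 - (real j)\<^sup>2)"
    using assms by (intro prod_square_diff_lower_bound) auto
  also have "r + 1 - k + k = r + 1" using assms by simp
  finally show ?thesis
    unfolding prod_odd_fact[of k, symmetric] pos_le_divide_eq[OF pos]
    by (simp add: mult_ac add.commute)
qed

lemma derivative_adapted_approximant:
  assumes F: "deriv_chain (r + 1) F" and k: "1 \<le> k" "k \<le> r"
    and A: "\<And>y. \<lbrakk>-1 \<le> y; y \<le> 1\<rbrakk> \<Longrightarrow> \<bar>F (r + 1) y\<bar> \<le> A"
    and B: "\<And>y. \<lbrakk>-1 \<le> y; y \<le> 1\<rbrakk> \<Longrightarrow> \<bar>F r y\<bar> \<le> B"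
  shows "\<exists>q. degree q \<le> r \<and>
     (\<forall>y\<in>{-1..1}. \<bar>F k y - poly ((pderiv ^^ k) q) y\<bar> \<le> 2 * A / (fact (r - k) * 2 ^ (r - k)) \<and>
        \<bar>F 0 y - poly q y\<bar> \<le> 8 * B / (fact k * fact (r - k) * 2 ^ r))"
proof -
  define l where "l = r - k"
  have r: "r = k + l" using k by (simp add: l_def)
  \<comment> \<open>The l-th derivative of \<open>s\<close> is the constant \<open>F r 0\<close>, so
    \<open>s\<close> fixes the r-th derivative of \<open>q\<close>.\<close>
  define s where "s = monom (F r 0 / fact l) l"
  obtain p where p: "\<forall>n. l \<le> Suc n \<longrightarrow> degree p \<le> n" "cheb_nodes l = {} \<longrightarrow> p = 0"
      "\<forall>z\<in>cheb_nodes l. poly p z = F k z - poly s z"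
    using poly_interpolation[OF cheb_nodes(1), of l "\<lambda>z. F k z - poly s z"]
    unfolding card_cheb_nodes by blast
  \<comment> \<open>The correction \<open>p\<close> has degree below \<open>l\<close>, and is zero
    for \<open>l = 0\<close>, so it leaves the coefficient set by \<open>s\<close>
    untouched.\<close>
  have cp: "coeff p l = 0" and dp: "degree p \<le> l"
  proof -
    have "p = 0" if "l = 0" using p(2) that by (simp add: cheb_nodes_def)
    moreover have "degree p < l" if "l \<noteq> 0" using p(1) that by (cases l) auto
    ultimately show "coeff p l = 0" "degree p \<le> l"
      by (cases "l = 0"; auto simp: coeff_eq_0)+
  qed
  have ds: "degree (s + p) \<le> l"
    using dp unfolding s_def by (intro degree_add_le degree_monom_le)
  obtain S where S: "(pderiv ^^ k) S = s + p" "degree S \<le> r"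
    using poly_antiderivative[of k "s + p"] ds unfolding r by auto
  \<comment> \<open>Adding \<open>u\<close> of degree below \<open>k\<close> adjusts the values at
    the zeros of T_k without changing the k-th derivative.\<close>
  obtain u where u: "degree u \<le> k - 1" "\<forall>z\<in>cheb_nodes k. poly u z = F 0 z - poly S z"
    using poly_interpolation[OF cheb_nodes(1), of k "\<lambda>z. F 0 z - poly S z"] k
    unfolding card_cheb_nodes by (metis Suc_diff_le diff_Suc_1 order_refl)
  have "(pderiv ^^ k) u = 0"
    using u(1) k by (subst pderiv_iterate_degree) (auto simp: coeff_eq_0)
  define q where "q = S + u"
  have qk: "(pderiv ^^ k) q = s + p"
    by (simp add: q_def higher_pderiv_add S \<open>(pderiv ^^ k) u = 0\<close>)
  have dq: "degree q \<le> r" using S(2) u(1) k unfolding q_def by (intro degree_add_le) auto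
  have "(pderiv ^^ r) q = (pderiv ^^ l) (s + p)"
    unfolding r add.commute[of k l] funpow_add o_apply qk ..
  then have qr: "(pderiv ^^ r) q = [:F r 0:]"
    using pderiv_iterate_degree[OF ds] by (simp add: cp s_def)
  define G where "G j y = F j y - poly ((pderiv ^^ j) q) y" for j y
  have G: "deriv_chain (r + 1) G"
    unfolding G_def by (intro deriv_chain_diff F deriv_chain_poly)
  then have Gk: "deriv_chain k G" by (rule deriv_chain_mono) (use k in auto)
  have Gl: "deriv_chain l (\<lambda>j. G (k + j))"
    by (rule deriv_chain_shift, rule deriv_chain_mono[OF G]) (simp add: r)
  have Gr: "G (k + l) y = F r y - F r 0" for y
    using qr by (simp add: G_def r[symmetric])
  have "G (k + l) y = F r y - F r 0" "\<bar>G (k + l) y\<bar> \<le> A" "\<bar>G (k + l) y\<bar> \<le> 2 * B"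
    if y: "-1 \<le> y" "y \<le> 1" for y
  proof -
    \<comment> \<open>The mean value inequality from 0 costs at most \<open>A\<close>, as all points
      are within distance 1 of 0; this is why the r-th derivative is matched at 0.\<close>
    have "norm (F r y - F r 0) \<le> A * norm (y - 0)"
      by (rule field_differentiable_bound[of "{-1..1}" _ "F (Suc r)"])
        (use deriv_chainD[OF F, of r] A y in auto)
    also have "\<dots> \<le> A * 1" using A[OF y] y by (intro mult_left_mono) auto
    finally show "\<bar>G (k + l) y\<bar> \<le> A" unfolding Gr by simp
    show "\<bar>G (k + l) y\<bar> \<le> 2 * B" unfolding Gr using B[OF y] B[of 0] by simp
  qed (rule Gr)
  note GA = this(2) and GB = this(3)
  have zl: "G (k + 0) z = 0" if "z \<in> cheb_nodes l" for z
    using p(3) that by (simp add: G_def qk)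
  have zk: "G 0 z = 0" if "z \<in> cheb_nodes k" for z
    using u(2) that by (simp add: G_def q_def)
  have 1: "\<bar>G k y\<bar> \<le> 2 * A / (fact l * 2 ^ l)" if "-1 \<le> y" "y \<le> 1" for y
    using vanishing_cheb_nodes_bound[of l "\<lambda>j. G (k + j)", OF Gl zl GA that] by simp
  have 2: "\<bar>G k y\<bar> \<le> 2 * (2 * B) / (fact l * 2 ^ l)" if "-1 \<le> y" "y \<le> 1" for y
    using vanishing_cheb_nodes_bound[of l "\<lambda>j. G (k + j)", OF Gl zl GB that] by simp
  \<comment> \<open>The node bound is used a second time, with order \<open>k\<close> and the
    estimate \<open>2\<close> for \<open>G k\<close>; this explains the constant 8.\<close>
  have 3: "\<bar>G 0 y\<bar> \<le> 8 * B / (fact k * fact l * 2 ^ r)" if "-1 \<le> y" "y \<le> 1" for y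
    using vanishing_cheb_nodes_bound[of k G, OF Gk zk 2 that]
    by (simp add: r power_add mult_ac)
  show ?thesis
    by (intro exI[of _ q]) (use dq 1 3 in \<open>auto simp: G_def l_def\<close>)
qed

section \<open>Lower bounds for the node polynomials\<close>

lemma omega_poly_sup_norm_lower_bound: "1 \<le> 2 ^ (m + p + 1) * sup_norm (omega_poly m p x1 x3)"
proof -
  define W where "W = (\<Prod>k\<le>m. [:- x1 k, 1:]) * (\<Prod>s\<le>p. [:- x3 s, 1:])"
  have W: "poly W y = omega_poly m p x1 x3 y" for y
    by (simp add: W_def omega_poly_def poly_prod)
  have "lead_coeff W = 1" unfolding W_def by (simp add: lead_coeff_mult lead_coeff_prod)
  moreover have "degree W = m + p + 2"
    unfolding W_def by (subst degree_mult_eq) (auto simp: degree_prod_eq_sum_degree)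
  moreover have "\<bar>poly W y\<bar> \<le> sup_norm (omega_poly m p x1 x3)" if "-1 \<le> y" "y \<le> 1" for y
    unfolding W using that
    by (intro abs_le_sup_norm) (auto simp: W[symmetric] intro!: continuous_intros)
  ultimately show ?thesis using monic_sup_lower_bound[of W "m + p + 2"] by simp
qed

lemma ell_poly_continuous: "continuous_on S (ell_poly m p x1 x3 j)"
  unfolding ell_poly_def divide_inverse by (intro continuous_intros)

lemma ell_poly_at_node:
  assumes "j \<le> p" "inj_on x3 {..p}" "\<And>k. k \<le> m \<Longrightarrow> x3 j \<noteq> x1 k"
  shows "ell_poly m p x1 x3 j (x3 j) = 1"
proof -
  have "(\<Prod>k\<le>m. (x3 j - x1 k) / (x3 j - x1 k)) = 1"
    using assms(3) by (intro prod.neutral) auto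
  moreover have "(\<Prod>s\<in>{..p} - {j}. (x3 j - x3 s) / (x3 j - x3 s)) = 1"
    using assms(1,2) by (intro prod.neutral) (auto dest: inj_onD)
  ultimately show ?thesis by (simp add: ell_poly_def)
qed

text \<open>The Lagrange function with index 0 equals 1 at its own node, which lies in [-1,1]; the
  other summands are nonnegative.\<close>

lemma sum_ell_poly_ge_1:
  assumes x3: "inj_on x3 {..p}" "\<And>j k. \<lbrakk>j \<le> p; k \<le> m\<rbrakk> \<Longrightarrow> x3 j \<noteq> x1 k" "x3 0 \<in> {-1..1}"
  shows "1 \<le> (\<Sum>j\<le>p. sup_norm (ell_poly m p x1 x3 j))"
proof -
  have bd: "\<bar>ell_poly m p x1 x3 j y\<bar> \<le> sup_norm (ell_poly m p x1 x3 j)"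
    if "-1 \<le> y" "y \<le> 1" for j y
    using that by (intro abs_le_sup_norm ell_poly_continuous)
  have "1 \<le> sup_norm (ell_poly m p x1 x3 0)"
    using bd[of "x3 0" 0] ell_poly_at_node[of 0 p x3 m x1] x3 by auto
  also have "\<dots> \<le> (\<Sum>j\<le>p. sup_norm (ell_poly m p x1 x3 j))"
    using bd[of 0] by (intro member_le_sum) (auto intro: order_trans[OF abs_ge_zero])
  finally show ?thesis .
qed

section \<open>Numerical estimates\<close>

text \<open>The start is narrow: 1.57^8 is about 36.9 against 36. Afterwards the left side grows by
  a factor at most 3/2, which is below pi/2.\<close>

lemma pi_half_power_lower_bound: "8 \<le> r \<Longrightarrow> 4 * real (r + 1) \<le> (pi / 2) ^ r"
proof (induction r rule: dec_induct)
  case base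
  have "(157 / 100) ^ 8 \<le> (pi / 2) ^ 8" using pi_approx by (intro power_mono) auto
  then show ?case by (simp add: power_divide)
next
  case (step r)
  have "4 * real (Suc r + 1) \<le> 4 * real (r + 1) * (3 / 2)" using step by simp
  also have "\<dots> \<le> (pi / 2) ^ r * (pi / 2)" using step pi_gt3 by (intro mult_mono) auto
  finally show ?case by (simp add: mult.commute)
qed

text \<open>By Pascal's rule the coefficient is a sum of two adjacent entries of row
  \<open>n\<close>, whose total is \<open>2 ^ n\<close>.\<close>

lemma binomial_le_half_pow: "2 * (Suc n choose k) \<le> 2 ^ Suc n"
proof (cases k)
  case (Suc j)
  have "(n choose j) + (n choose Suc j) = (\<Sum>i\<in>{j, Suc j}. n choose i)" by simp
  also have "\<dots> = (\<Sum>i\<in>{j, Suc j} \<inter> {..n}. n choose i)"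
    by (intro sum.mono_neutral_right) (auto simp: not_le binomial_eq_0)
  also have "\<dots> \<le> (\<Sum>i\<le>n. n choose i)" by (intro sum_mono2) auto
  also have "\<dots> = 2 ^ n" by (rule choose_row_sum)
  finally show ?thesis using Suc by simp
qed simp

text \<open>With s the square root of \<open>n\<close>, the floors give m + p + 2 > 3.12 s, while
  \<open>m + p + 1 \<le> n\<close> turns this into 3.12 s < s^2 + 1. As s >= 1, this forces s to be
  large.\<close>

lemma node_count_lower_bound:
  assumes "n > 0" "m = nat \<lfloor>pi * sqrt (real n / 2)\<rfloor>"
    "p = nat \<lfloor>pi / sqrt 2 * sqrt (real n / 6)\<rfloor>" "m + p + 1 \<le> n"
  shows "8 \<le> m + p + 1"
proof -
  define s where "s = sqrt (real n)"
  have ss: "s * s = real n" and s1: "1 \<le> s" using assms(1) by (auto simp: s_def)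
  have pi: "3.14 \<le> pi" using pi_approx by simp
  have "0.707 * s \<le> sqrt (real n / 2)"
    by (rule real_le_rsqrt) (simp add: power2_eq_square ss[symmetric])
  then have "3.14 * (0.707 * s) \<le> pi * sqrt (real n / 2)"
    using pi s1 by (intro mult_mono) auto
  moreover have "pi * sqrt (real n / 2) < real m + 1" unfolding assms(2) by linarith
  moreover have "3.14 * (0.288 * s) \<le> pi / sqrt 2 * sqrt (real n / 6)"
  proof -
    have "0.288 * s \<le> sqrt (real n / 12)"
      by (rule real_le_rsqrt) (simp add: power2_eq_square ss[symmetric])
    then have "3.14 * (0.288 * s) \<le> pi * sqrt (real n / 12)"
      using pi s1 by (intro mult_mono) auto
    also have "sqrt (real n / 12) = sqrt (real n / 6) / sqrt 2"
      unfolding real_sqrt_divide[symmetric] by simp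
    finally show ?thesis by simp
  qed
  moreover have "pi / sqrt 2 * sqrt (real n / 6) < real p + 1" unfolding assms(3) by linarith
  ultimately have lo: "3.12 * s < real (m + p + 1) + 1" using s1 by simp
  then have "3.12 * s < s * s + 1" using assms(4) unfolding ss by simp
  have "2.75 < s"
  proof (rule ccontr)
    assume "\<not> 2.75 < s"
    \<comment> \<open>On [1, 2.75] the square lies below its chord \<open>3.75 * s - 2.75\<close>,
      which is incompatible with \<open>3.12 * s < s * s + 1\<close>.\<close>
    then have "0 \<le> (s - 1) * (2.75 - s)" using s1 by (intro mult_nonneg_nonneg) auto
    also have "(s - 1) * (2.75 - s) = 3.75 * s - 2.75 - s * s" by (simp add: field_simps)
    finally have "s * s \<le> 3.75 * s - 2.75" by simp
    then show False using \<open>3.12 * s < s * s + 1\<close> \<open>\<not> 2.75 < s\<close> by simp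
  qed
  then have "2.75 * 2.75 < s * s" by (intro mult_strict_mono) auto
  \<comment> \<open>Integrality: \<open>n\<close> exceeds 7.5625. The improved bound 2.8 for
    \<open>s\<close> then gives m + p + 2 > 8.7.\<close>
  then have "8 \<le> real n" unfolding ss by simp
  then have "2.8 \<le> s" unfolding s_def by (intro real_le_rsqrt) (simp add: power2_eq_square)
  then show ?thesis using lo by simp
qed

section \<open>Assembly of the two terms\<close>

theorem theorem4:
  fixes n m p r q \<nu> :: nat
    and x x1 t x2 x3 :: "nat \<Rightarrow> real"
    and f :: "real \<Rightarrow> real"
    and M :: "real mat"
  assumes "n > 0"
    and "m = nat \<lfloor>pi * sqrt (real n / 2)\<rfloor>"
    and "p = nat \<lfloor>pi / sqrt 2 * sqrt (real n / 6)\<rfloor>"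
    and "r = m + p + 1"
    and "r \<le> n"
    and "q = nat \<lfloor>real n / 6\<rfloor>"
    and "mock_chebyshev (equispaced n) m x1"
    and "bij_betw x {..n} (equispaced n)"
    and "\<forall>i\<le>m. x i = x1 i"
    and "internal_equispaced q t"
    and "mimics (equispaced n - x1 ` {..m}) {..<q} t x2"
    and "mock_chebyshev (x2 ` {..<q}) p x3"
    and "M = kkt_mat n m r x"
    and "C_diff (r + 1) f"
    and "\<nu> \<in> {1..r}"
  shows
    "sup_norm (nderiv \<nu> (\<lambda>y. f y - cmcls n m r x f y)) =
       sup_norm (\<lambda>y. nderiv \<nu> f y - nderiv \<nu> (cmcls n m r x f) y) \<and>
     sup_norm (\<lambda>y. nderiv \<nu> f y - nderiv \<nu> (cmcls n m r x f) y) \<le>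
       (\<Prod>j<\<nu>. (real r + 1)^2 - (real j)^2) / (\<Prod>j<\<nu>. 2 * real j + 1) *
         sup_norm (omega_poly m p x1 x3) *
         (sup_norm (nderiv (r + 1) f) / (fact \<nu> * fact (r + 1 - \<nu>))) +
       (\<Prod>j<\<nu>. (real r)^2 - (real j)^2) / (\<Prod>j<\<nu>. 2 * real j + 1) *
         (\<Sum>k\<le>p. sup_norm (ell_poly m p x1 x3 k) * (pi / 2)^r * (1 + B_const m r M) *
            (sup_norm (nderiv r f) / fact (r + 1)))"
proof -
  define A where "A = sup_norm (nderiv (r + 1) f)"
  define F where "F = sup_norm (nderiv r f)"
  define B where "B = B_const m r M"
  define c where "c = (\<Prod>j<\<nu>. (real r)^2 - (real j)^2) / (\<Prod>j<\<nu>. 2 * real j + 1)"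
  define c' where "c' = (\<Prod>j<\<nu>. (real r + 1)^2 - (real j)^2) / (\<Prod>j<\<nu>. 2 * real j + 1)"
  define \<Omega> where "\<Omega> = sup_norm (omega_poly m p x1 x3)"
  define L where "L = (\<Sum>k\<le>p. sup_norm (ell_poly m p x1 x3 k))"
  define l where "l = r - \<nu>"
  have \<nu>: "1 \<le> \<nu>" "\<nu> \<le> r" using assms(15) by auto
  have mr: "m \<le> r" using assms(4) by simp
  have r8: "8 \<le> r" using node_count_lower_bound[OF assms(1-3)] assms(4,5) by simp
  have grid: "equispaced n \<subseteq> {-1..1}"
  proof -
    have "2 / real n * real i \<le> 2" if "i \<le> n" for i
      using assms(1) that by (simp add: field_simps)
    then show ?thesis by (fastforce simp: equispaced_def)
  qed
  have inj: "inj_on x {..n}" using assms(8) by (auto simp: bij_betw_def)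
  have xi: "x i \<in> {-1..1}" if "i \<le> n" for i
    using assms(8) grid that unfolding bij_betw_def by blast
  have x3: "inj_on x3 {..p}" using assms(12) by (simp add: mock_chebyshev_def mimics_def)
  \<comment> \<open>The nodes \<open>x3\<close> are taken among \<open>x2\<close>, which avoid
    \<open>x1\<close>; hence the Lagrange denominators do not vanish.\<close>
  have x3_mem: "x3 j \<in> equispaced n - x1 ` {..m}" if "j \<le> p" for j
  proof -
    have "x3 j \<in> x2 ` {..<q}" using assms(12) that by (simp add: mock_chebyshev_def mimics_def)
    then obtain i where i: "i < q" "x3 j = x2 i" by auto
    have "x2 i \<in> equispaced n - x1 ` {..m}"
      using assms(11) i(1) unfolding mimics_def by auto
    then show ?thesis by (simp only: i(2))
  qed
  have L1: "1 \<le> L"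
    unfolding L_def
  proof (rule sum_ell_poly_ge_1[OF x3])
    show "x3 j \<noteq> x1 k" if "j \<le> p" "k \<le> m" for j k using x3_mem[of j] that by auto
    show "x3 0 \<in> {-1..1}" using x3_mem[of 0] grid by blast
  qed
  have \<Omega>1: "1 \<le> 2 ^ r * \<Omega>"
    unfolding \<Omega>_def assms(4) by (rule omega_poly_sup_norm_lower_bound)
  have chain: "deriv_chain (r + 1) (\<lambda>j. nderiv j f)"
    by (rule C_diff_deriv_chain[OF assms(14)])
  have Abd: "\<bar>nderiv (r + 1) f y\<bar> \<le> A" if "-1 \<le> y" "y \<le> 1" for y
    unfolding A_def using assms(14) that by (intro abs_le_sup_norm) (auto simp: C_diff_def)
  have Fbd: "\<bar>nderiv r f y\<bar> \<le> F" if "-1 \<le> y" "y \<le> 1" for y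
    unfolding F_def using deriv_chain_continuous[OF chain, of r] that
    by (intro abs_le_sup_norm) auto
  have A0: "0 \<le> A" and F0: "0 \<le> F" using Abd[of 0] Fbd[of 0] by auto
  have B0: "0 \<le> B" unfolding B_def assms(13) by (rule B_const_nonneg[OF inj xi mr assms(5)])
  obtain h where h: "degree h \<le> r"
    "\<And>y. y \<in> {-1..1} \<Longrightarrow> \<bar>nderiv \<nu> f y - poly ((pderiv ^^ \<nu>) h) y\<bar> \<le> 2 * A / (fact l * 2 ^ l)"
    "\<And>y. y \<in> {-1..1} \<Longrightarrow> \<bar>nderiv 0 f y - poly h y\<bar> \<le> 8 * F / (fact \<nu> * fact l * 2 ^ r)"
    using derivative_adapted_approximant[OF chain \<nu> Abd Fbd] unfolding l_def by blast
  have hF: "\<bar>f y - poly h y\<bar> \<le> 4 * F / fact r" if "-1 \<le> y" "y \<le> 1" for y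
  proof -
    \<comment> \<open>The binomial estimate trades the denominator
      \<open>fact \<nu> * fact l * 2 ^ r\<close> for \<open>2 * fact r\<close>.\<close>
    have "2 * (r choose \<nu>) \<le> 2 ^ r" using binomial_le_half_pow[of "r - 1" \<nu>] r8 by simp
    then have "2 * real (r choose \<nu>) \<le> 2 ^ r"
      by (metis of_nat_le_iff of_nat_mult of_nat_numeral of_nat_power)
    then have bin: "2 * fact r \<le> 2 ^ r * (fact \<nu> * fact l :: real)"
      unfolding binomial_fact[OF \<nu>(2)] l_def by (simp add: field_simps)
    have "\<bar>f y - poly h y\<bar> \<le> 8 * F / (fact \<nu> * fact l * 2 ^ r)"
      using h(3)[of y] that by (simp add: nderiv_def)
    also have "\<dots> \<le> 8 * F / (2 * fact r)"
      using bin F0 by (intro divide_left_mono) (auto simp: mult_ac)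
    finally show ?thesis by simp
  qed
  obtain w where w: "\<And>y. y \<in> {-1..1} \<Longrightarrow>
      cmcls n m r x f y = poly (h + (\<Sum>i\<le>r. Polynomial.smult (w i) (cheb_poly i))) y"
    "(\<Sum>i\<le>r. \<bar>w i\<bar>) \<le> B * (4 * F / fact r)"
    using cmcls_near_polynomial[OF inj xi mr assms(5) h(1) hF] unfolding B_def assms(13) by blast
  define Q where "Q = h + (\<Sum>i\<le>r. Polynomial.smult (w i) (cheb_poly i))"
  have dP: "nderiv \<nu> (cmcls n m r x f) y = poly ((pderiv ^^ \<nu>) Q) y" if "y \<in> {-1..1}" for y
    using that w(1) by (intro nderiv_deriv_chain[OF deriv_chain_poly[of \<nu>]]) (auto simp: Q_def)
  have dR: "nderiv \<nu> (\<lambda>y. f y - cmcls n m r x f y) y =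
      nderiv \<nu> f y - poly ((pderiv ^^ \<nu>) Q) y" if "y \<in> {-1..1}" for y
    using that \<nu> w(1)
    by (intro nderiv_deriv_chain[OF deriv_chain_diff[OF chain deriv_chain_poly]])
      (auto simp: Q_def nderiv_def)
  have term1: "2 * A / (fact l * 2 ^ l) \<le> c' * \<Omega> * (A / (fact \<nu> * fact (r + 1 - \<nu>)))"
  proof -
    have rl: "r + 1 - \<nu> = Suc l" "r = \<nu> + l" using \<nu> by (auto simp: l_def)
    have "2 * (2 ^ \<nu> * fact \<nu>) * real (Suc l) \<le> c'"
      using cheb_deriv_factor_lower_bound[OF \<nu>] unfolding c'_def rl(1) .
    then have "2 * (2 ^ \<nu> * fact \<nu>) * real (Suc l) * 1 \<le> c' * (2 ^ r * \<Omega>)"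
      using \<Omega>1 by (intro mult_mono) (auto intro: order_trans[rotated])
    then have "(2 * (2 ^ \<nu> * fact \<nu>) * real (Suc l)) * (A / (2 ^ r * (fact \<nu> * fact (Suc l)))) \<le>
        (c' * (2 ^ r * \<Omega>)) * (A / (2 ^ r * (fact \<nu> * fact (Suc l))))"
      using A0 by (intro mult_right_mono) auto
    also have "(2 * (2 ^ \<nu> * fact \<nu>) * real (Suc l)) * (A / (2 ^ r * (fact \<nu> * fact (Suc l)))) =
        2 * A / (fact l * 2 ^ l)"
    proof -
      \<comment> \<open>The cancellation is isolated in variables: \<open>a\<close> is
        \<open>2 ^ \<nu>\<close>, \<open>b\<close> is \<open>fact \<nu>\<close>, \<open>d\<close> is
        \<open>l + 1\<close>, \<open>u\<close> is \<open>2 ^ l\<close> and \<open>v\<close> is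
        \<open>fact l\<close>.\<close>
      have "(2 * (a * b) * d) * (A / ((a * u) * (b * (d * v)))) = 2 * A / (v * u)"
        if "a \<noteq> 0" "b \<noteq> 0" "d \<noteq> 0" for a b d u v :: real
        using that by simp
      then show ?thesis unfolding rl(2) power_add fact_Suc by simp
    qed
    also have "(c' * (2 ^ r * \<Omega>)) * (A / (2 ^ r * (fact \<nu> * fact (Suc l)))) =
        c' * \<Omega> * (A / (fact \<nu> * fact (Suc l)))"
      by simp
    finally show ?thesis unfolding rl(1) .
  qed
  have c: "c = poly ((pderiv ^^ \<nu>) (cheb_poly r)) 1" by (simp add: c_def cheb_poly_deriv_at_1)
  have c0: "0 \<le> c"
    unfolding c using cheb_poly_deriv_bound[of 1 \<nu> r] by simp
  have term2: "\<bar>poly ((pderiv ^^ \<nu>) (\<Sum>i\<le>r. Polynomial.smult (w i) (cheb_poly i))) y\<bar> \<le>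
      c * (L * ((pi / 2)^r * (1 + B) * (F / fact (r + 1))))" if y: "-1 \<le> y" "y \<le> 1" for y
  proof -
    have "\<bar>poly ((pderiv ^^ \<nu>) (\<Sum>i\<le>r. Polynomial.smult (w i) (cheb_poly i))) y\<bar> =
        \<bar>\<Sum>i\<le>r. w i * poly ((pderiv ^^ \<nu>) (cheb_poly i)) y\<bar>"
      by (simp add: higher_pderiv_sum higher_pderiv_smult poly_sum)
    also have "\<dots> \<le> (\<Sum>i\<le>r. \<bar>w i\<bar> * c)"
    proof (intro order_trans[OF sum_abs] sum_mono)
      fix i assume "i \<in> {..r}"
      then have "\<bar>poly ((pderiv ^^ \<nu>) (cheb_poly i)) y\<bar> \<le> c"
        unfolding c using order_trans[OF cheb_poly_deriv_bound[OF y] cheb_poly_deriv_at_1_mono] by simp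
      then show "\<bar>w i * poly ((pderiv ^^ \<nu>) (cheb_poly i)) y\<bar> \<le> \<bar>w i\<bar> * c"
        unfolding abs_mult by (intro mult_left_mono) auto
    qed
    also have "\<dots> = c * (\<Sum>i\<le>r. \<bar>w i\<bar>)" by (simp add: sum_distrib_left mult.commute)
    also have "\<dots> \<le> c * (B * (4 * F / fact r))" by (intro mult_left_mono w(2) c0)
    also have "\<dots> \<le> c * (L * ((pi / 2)^r * (1 + B) * (F / fact (r + 1))))"
    proof (intro mult_left_mono c0)
      \<comment> \<open>Passing from \<open>fact r\<close> to \<open>fact (r + 1)\<close> produces
        the factor \<open>r + 1\<close>, which together with 4 is absorbed by
        \<open>(pi / 2)^r\<close>; \<open>L\<close> enters as a factor at least 1.\<close>
      have "B * (4 * F / fact r) = (4 * real (r + 1)) * B * (F / fact (r + 1))"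
        unfolding Suc_eq_plus1[symmetric] fact_Suc by (simp del: of_nat_Suc)
      also have "\<dots> \<le> (pi / 2)^r * (1 + B) * (F / fact (r + 1))"
        using pi_half_power_lower_bound[OF r8] B0 F0 by (intro mult_mono) auto
      also have "\<dots> = 1 * ((pi / 2)^r * (1 + B) * (F / fact (r + 1)))" by simp
      also have "\<dots> \<le> L * ((pi / 2)^r * (1 + B) * (F / fact (r + 1)))"
        using L1 B0 F0 by (intro mult_right_mono mult_nonneg_nonneg) auto
      finally show "B * (4 * F / fact r) \<le> L * ((pi / 2)^r * (1 + B) * (F / fact (r + 1)))" .
    qed
    finally show ?thesis .
  qed
  have bound: "sup_norm (\<lambda>y. nderiv \<nu> f y - nderiv \<nu> (cmcls n m r x f) y) \<le>
      c' * \<Omega> * (A / (fact \<nu> * fact (r + 1 - \<nu>))) +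
      c * (L * ((pi / 2)^r * (1 + B) * (F / fact (r + 1))))"
  proof (rule sup_norm_le)
    fix y :: real assume y: "-1 \<le> y" "y \<le> 1"
    have "\<bar>nderiv \<nu> f y - nderiv \<nu> (cmcls n m r x f) y\<bar> \<le>
        \<bar>nderiv \<nu> f y - poly ((pderiv ^^ \<nu>) h) y\<bar> +
        \<bar>poly ((pderiv ^^ \<nu>) (\<Sum>i\<le>r. Polynomial.smult (w i) (cheb_poly i))) y\<bar>"
      using dP[of y] y by (simp add: Q_def higher_pderiv_add)
    then show "\<bar>nderiv \<nu> f y - nderiv \<nu> (cmcls n m r x f) y\<bar> \<le>
        c' * \<Omega> * (A / (fact \<nu> * fact (r + 1 - \<nu>))) +
        c * (L * ((pi / 2)^r * (1 + B) * (F / fact (r + 1))))"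
      using h(2)[of y] term1 term2[OF y] y by simp
  qed
  have sum: "L * ((pi / 2)^r * (1 + B) * (F / fact (r + 1))) =
      (\<Sum>k\<le>p. sup_norm (ell_poly m p x1 x3 k) * (pi / 2)^r * (1 + B) * (F / fact (r + 1)))"
    unfolding L_def sum_distrib_right by (simp only: mult.assoc)
  have eq: "sup_norm (nderiv \<nu> (\<lambda>y. f y - cmcls n m r x f y)) =
       sup_norm (\<lambda>y. nderiv \<nu> f y - nderiv \<nu> (cmcls n m r x f) y)"
    by (rule sup_norm_cong) (simp add: dP dR)
  show ?thesis
    using bound unfolding sum eq unfolding A_def F_def B_def c_def c'_def \<Omega>_def
    by (rule conjI[OF refl])
qed

end
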